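(* Consider a universe $\mathcal{U}$ of keys, where $|\mathcal{U}|$ is assumed to be a sufficiently large polynomial in $n$. If a dereference table with $n$ slots and keys from $\mathcal{U}$ supports fixed-sized tiny pointers of size $s$ bits and load factor $1-\delta=\Omega(1)$, then $s=\Omega(\log\log\log n+\log\delta^{-1})$.
   Context: Dereference tables. A dereference table with $q$-bit values is a data structure supporting: $\mathrm{Create}(n,q)$, which creates a table with an array of $n$ slots of $q$ bits each, called the store; $\mathrm{Allocate}(k)$, which, given a key $k$, allocates a slot of the store to $k$ and returns a bit string $p$ called a tiny pointer; $\mathrm{Dereference}(k,p)$, which returns the index of the slot allocated to $k$ if $p$ is the tiny pointer returned by the most recent call $\mathrm{Allocate}(k)$ (and may return an arbitrary index if $p$ is not valid for $k$); and $\mathrm{Free}(k,p)$, called only on valid pairs, which deallocates slot $\mathrm{Dereference}(k,p)$. Each key holds at most one allocation at a time: after $\mathrm{Allocate}(k)$ returns $p$, $\mathrm{Free}(k,p)$ must be called before $\mathrm{Allocate}(k)$ is called again. A key is present if it has been allocated more recently than freed. Guarantees: for distinct present keys $k_1\ne k_2$ with tiny pointers $p_1,p_2$, $\mathrm{Dereference}(k_1,p_1)\neq \mathrm{Dereference}(k_2,p_2)$; and $\mathrm{Dereference}(k,p)$ depends only on $k$, $p$, random bits, and $n$. Load factor $1-\delta$ means the table supports up to $(1-\delta)n$ simultaneous allocations. Each allocation (made when fewer than $(1-\delta)n$ allocations are live) may fail with probability at most $1/\mathrm{poly}(n)$. The sequence of operations is chosen by an oblivious adversary (fixed in advance, independently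 of the table's random bits). "Fixed-sized tiny pointers of size $s$" means that every tiny pointer returned has size at most $s$ bits.
   Formalization: The formal theorem additionally assumes that 1/δ is bounded by some polynomial in n; without this the claim fails, e.g. for δ = 2^(-n²), where pointers of ⌈log n⌉ bits always suffice although log(1/δ) is of order n². *)

theory Defs
  imports "HOL-Probability.Probability" "HOL-Library.Landau_Symbols"
begin

text \<open>
  The argument of type \<open>'w\<close> is the outcome of all random bits used by the structure. For a fixed
  outcome the operations are deterministic; \<open>'s\<close> is the type of internal states. \<open>create\<close> receives
  the number \<open>n\<close> of slots and the number \<open>q\<close> of bits per slot. The type of \<open>dereference\<close> expresses
  that it sees only the random bits, \<open>n\<close>, the key and the tiny pointer, but not the state.
  An allocation returning \<open>None\<close> has failed. The contents of the store are written and read by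
  the user of the structure and are not represented.
\<close>

type_synonym tiny_pointer = "bool list"

record ('w, 'k, 's) deref_table =
  create :: "'w \<Rightarrow> nat \<Rightarrow> nat \<Rightarrow> 's"
  allocate :: "'w \<Rightarrow> 's \<Rightarrow> 'k \<Rightarrow> tiny_pointer option \<times> 's"
  dereference :: "'w \<Rightarrow> nat \<Rightarrow> 'k \<Rightarrow> tiny_pointer \<Rightarrow> nat"
  free :: "'w \<Rightarrow> 's \<Rightarrow> 'k \<Rightarrow> tiny_pointer \<Rightarrow> 's"

text \<open>
  An oblivious adversary is a fixed list of requests. It cannot know tiny pointers, so a request
  names a key only; the pointer passed to \<open>free\<close> is supplied during execution.
\<close>

datatype 'k request = Allocate 'k | Free 'k

text \<open>
  Admissible continuations when the keys in \<open>L\<close> are live. Since the adversary does not see failures,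
  a requested and not yet released allocation counts as live whether or not it failed.
  The capacity \<open>c\<close> is real-valued because it will be \<open>(1 - \<delta>) n\<close>.
\<close>

fun admissible_from :: "'k set \<Rightarrow> real \<Rightarrow> 'k set \<Rightarrow> 'k request list \<Rightarrow> bool" where
  "admissible_from U c L [] \<longleftrightarrow> True"
| "admissible_from U c L (Allocate k # rs) \<longleftrightarrow>
     k \<in> U \<and> k \<notin> L \<and> real (card L) < c \<and> admissible_from U c (insert k L) rs"
| "admissible_from U c L (Free k # rs) \<longleftrightarrow> k \<in> L \<and> admissible_from U c (L - {k}) rs"

definition admissible :: "'k set \<Rightarrow> real \<Rightarrow> 'k request list \<Rightarrow> bool" where
  "admissible U c rs \<longleftrightarrow> admissible_from U c {} rs"

text \<open>
  Configurations pair the internal state with the map from present keys to their tiny pointers.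
  A \<open>Free\<close> request for a key whose allocation failed is skipped, because \<open>free\<close> may only be called
  on valid pairs.
\<close>

fun step :: "('w, 'k, 's) deref_table \<Rightarrow> 'w \<Rightarrow> 's \<times> ('k \<rightharpoonup> tiny_pointer) \<Rightarrow> 'k request
    \<Rightarrow> 's \<times> ('k \<rightharpoonup> tiny_pointer)" where
  "step D w (st, P) (Allocate k) = (let (r, st') = allocate D w st k in (st', P(k := r)))"
| "step D w (st, P) (Free k) =
     (case P k of None \<Rightarrow> (st, P) | Some p \<Rightarrow> (free D w st k p, P(k := None)))"

definition execute :: "('w, 'k, 's) deref_table \<Rightarrow> nat \<Rightarrow> nat \<Rightarrow> 'w \<Rightarrow> 'k request list
    \<Rightarrow> 's \<times> ('k \<rightharpoonup> tiny_pointer)" where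
  "execute D n q w rs = foldl (step D w) (create D w n q, Map.empty) rs"

definition pointers :: "('w, 'k, 's) deref_table \<Rightarrow> nat \<Rightarrow> nat \<Rightarrow> 'w \<Rightarrow> 'k request list
    \<Rightarrow> 'k \<rightharpoonup> tiny_pointer" where
  "pointers D n q w rs = snd (execute D n q w rs)"

definition correct_slots ::
    "'w measure \<Rightarrow> ('w, 'k, 's) deref_table \<Rightarrow> nat \<Rightarrow> nat \<Rightarrow> 'k set \<Rightarrow> real \<Rightarrow> bool" where
  "correct_slots M D n q U c \<longleftrightarrow>
     (\<forall>rs w. admissible U c rs \<longrightarrow> w \<in> space M \<longrightarrow>
        (\<forall>k p. pointers D n q w rs k = Some p \<longrightarrow> dereference D w n k p < n) \<and>
        (\<forall>k\<^sub>1 k\<^sub>2 p\<^sub>1 p\<^sub>2. k\<^sub>1 \<noteq> k\<^sub>2 \<longrightarrow>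
           pointers D n q w rs k\<^sub>1 = Some p\<^sub>1 \<longrightarrow> pointers D n q w rs k\<^sub>2 = Some p\<^sub>2 \<longrightarrow>
           dereference D w n k\<^sub>1 p\<^sub>1 \<noteq> dereference D w n k\<^sub>2 p\<^sub>2))"

definition failure_event :: "'w measure \<Rightarrow> ('w, 'k, 's) deref_table \<Rightarrow> nat \<Rightarrow> nat
    \<Rightarrow> 'k request list \<Rightarrow> 'k \<Rightarrow> 'w set" where
  "failure_event M D n q rs k = {w \<in> space M. pointers D n q w (rs @ [Allocate k]) k = None}"

definition failure_bounded :: "'w measure \<Rightarrow> ('w, 'k, 's) deref_table \<Rightarrow> nat \<Rightarrow> nat
    \<Rightarrow> 'k set \<Rightarrow> real \<Rightarrow> real \<Rightarrow> bool" where
  "failure_bounded M D n q U c \<epsilon> \<longleftrightarrow>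
     (\<forall>rs k. admissible U c (rs @ [Allocate k]) \<longrightarrow>
        failure_event M D n q rs k \<in> sets M \<and> measure M (failure_event M D n q rs k) \<le> \<epsilon>)"

definition supports_load_factor :: "'w measure \<Rightarrow> ('w, 'k, 's) deref_table \<Rightarrow> nat \<Rightarrow> nat
    \<Rightarrow> 'k set \<Rightarrow> real \<Rightarrow> real \<Rightarrow> bool" where
  "supports_load_factor M D n q U load \<epsilon> \<longleftrightarrow>
     correct_slots M D n q U (load * real n) \<and> failure_bounded M D n q U (load * real n) \<epsilon>"

definition fixed_size_pointers :: "'w measure \<Rightarrow> ('w, 'k, 's) deref_table \<Rightarrow> nat \<Rightarrow> nat
    \<Rightarrow> 'k set \<Rightarrow> real \<Rightarrow> nat \<Rightarrow> bool" where
  "fixed_size_pointers M D n q U load s \<longleftrightarrow>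
     (\<forall>rs w k p. admissible U (load * real n) rs \<longrightarrow> w \<in> space M \<longrightarrow>
        pointers D n q w rs k = Some p \<longrightarrow> length p \<le> s)"

definition inverse_poly :: "(nat \<Rightarrow> real) \<Rightarrow> bool" where
  "inverse_poly f \<longleftrightarrow> (\<exists>a>0. f \<in> O(\<lambda>n. real n powr - a))"

definition poly_bounded :: "(nat \<Rightarrow> real) \<Rightarrow> bool" where
  "poly_bounded f \<longleftrightarrow> (\<exists>a. f \<in> O(\<lambda>n. real n powr a))"

end

theory Submission
  imports Defs "HOL-Real_Asymp.Real_Asymp"
begin

text \<open>
  The adversary requests keys drawn independently and uniformly from the universe, so that for fixed
  random bits the set of possible slots of the next key is a fresh sample from a fixed distribution.
  Let \<open>d\<close> be the number of bit strings of length at most \<open>s\<close>; each key has at most \<open>d\<close> slots.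

  For the triple logarithm, only insert. Suppose that a fraction \<open>f\<close> of all keys has at least \<open>j\<close>
  pointers leading to occupied slots. Among these keys, at least half have only slots
  that are heavy, meaning that a fraction of at least \<open>f/(2n)\<close> of all keys belongs to the set and may
  use the slot. Serving one of them blocks one more pointer for each such key, so after a phase of
  \<open>\<Omega>(n/d)\<close> insertions the fraction of keys with at least \<open>j + 1\<close> blocked pointers is of order
  \<open>f\<^sup>2/d\<^sup>2\<close>, up to failures. After \<open>d\<close> phases a fraction of \<open>d\<close> to the power
  \<open>-O(2\<^sup>d)\<close> of all keys has no free slot, and this must not exceed the failure probability.

  For \<open>log \<delta>\<^sup>-\<^sup>1\<close>, fill the table up to \<open>u\<close> free slots, free a random block of \<open>T = O(u)\<close> keys and insert
  \<open>T\<close> new ones. At most \<open>O(d u)\<close> slots are used by a fraction of more than \<open>\<Omega>(1/u)\<close> of all keys. The free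
  slots below this threshold serve only half of the keys, hence \<open>T/2\<close> new keys have to be served by
  free slots above it. There are at most \<open>u + O(d u) T/n\<close> of them, which forces \<open>d = \<Omega>(n/u)\<close>.
\<close>

subsection \<open>Averages over lists of keys\<close>

text \<open>Expectation over \<open>t\<close> independent uniform keys as nested conditional means.
  The head of a list is the newest key, so the inner mean is conditional on the older history
  \<open>h\<close>.\<close>

primrec avg_lists :: "'k set \<Rightarrow> nat \<Rightarrow> ('k list \<Rightarrow> real) \<Rightarrow> real" where
  "avg_lists U 0 f = f []"
| "avg_lists U (Suc t) f = avg_lists U t (\<lambda>h. (\<Sum>k\<in>U. f (k # h)) / real (card U))"

lemma avg_lists_mono:
  assumes "\<And>h. set h \<subseteq> U \<Longrightarrow> length h = t \<Longrightarrow> f h \<le> g h"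
  shows "avg_lists U t f \<le> avg_lists U t g"
  using assms
proof (induction t arbitrary: f g)
  case (Suc t)
  have "(\<Sum>k\<in>U. f (k # h)) / real (card U) \<le> (\<Sum>k\<in>U. g (k # h)) / real (card U)"
    if "set h \<subseteq> U" "length h = t" for h
    using that by (intro divide_right_mono sum_mono Suc.prems) auto
  then show ?case
    using Suc.IH by simp
qed simp

lemma avg_lists_cong:
  assumes "\<And>h. set h \<subseteq> U \<Longrightarrow> length h = t \<Longrightarrow> f h = g h"
  shows "avg_lists U t f = avg_lists U t g"
  using assms by (intro antisym avg_lists_mono) auto

lemma avg_lists_add:
  "avg_lists U t (\<lambda>h. f h + g h) = avg_lists U t f + avg_lists U t g"
  by (induction t arbitrary: f g) (simp_all add: sum.distrib add_divide_distrib)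

lemma avg_lists_cmult:
  "avg_lists U t (\<lambda>h. c * f h) = c * avg_lists U t f"
proof (induction t arbitrary: f)
  case (Suc t)
  show ?case
    by (simp add: sum_distrib_left [symmetric] Suc.IH [symmetric])
qed simp

lemma avg_lists_diff:
  "avg_lists U t (\<lambda>h. f h - g h) = avg_lists U t f - avg_lists U t g"
  using avg_lists_add [of U t f "\<lambda>h. (-1) * g h"] avg_lists_cmult [of U t "-1" g] by simp

lemma avg_lists_const:
  assumes "finite U" "U \<noteq> {}"
  shows "avg_lists U t (\<lambda>_. c) = c"
  using assms by (induction t arbitrary: c) auto

text \<open>Tower property: \<open>h\<close> holds the \<open>t\<close> older keys,
  \<open>h'\<close> the \<open>u\<close> newer ones.\<close>

lemma avg_lists_append:
  "avg_lists U (t + u) f = avg_lists U t (\<lambda>h. avg_lists U u (\<lambda>h'. f (h' @ h)))"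
proof (induction u arbitrary: f)
  case (Suc u)
  have "avg_lists U (t + Suc u) f
      = avg_lists U (t + u) (\<lambda>h. (\<Sum>k\<in>U. f (k # h)) / real (card U))"
    by simp
  also have "\<dots> = avg_lists U t (\<lambda>h. avg_lists U u (\<lambda>h'. (\<Sum>k\<in>U. f (k # h' @ h)) / real (card U)))"
    by (rule Suc.IH)
  finally show ?case by simp
qed simp

text \<open>The variance around the mean \<open>c\<close> is nonnegative.\<close>

lemma avg_lists_jensen_square:
  assumes "finite U" "U \<noteq> {}"
  shows "(avg_lists U t f)\<^sup>2 \<le> avg_lists U t (\<lambda>h. (f h)\<^sup>2)"
proof -
  define c where "c = avg_lists U t f"
  have "0 = avg_lists U t (\<lambda>_. 0)"
    using assms by (simp add: avg_lists_const)
  also have "\<dots> \<le> avg_lists U t (\<lambda>h. (f h)\<^sup>2 - (2 * c) * f h + c\<^sup>2)"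
  proof (rule avg_lists_mono)
    fix h show "0 \<le> (f h)\<^sup>2 - (2 * c) * f h + c\<^sup>2"
      using zero_le_power2 [of "f h - c"] by (simp add: power2_diff algebra_simps)
  qed
  also have "\<dots> = avg_lists U t (\<lambda>h. (f h)\<^sup>2) - (2 * c) * c + c\<^sup>2"
    using assms by (simp only: avg_lists_add avg_lists_diff avg_lists_cmult avg_lists_const [OF assms] c_def)
  finally show ?thesis
    by (simp add: c_def power2_eq_square)
qed

text \<open>Conditional expected gains telescope. Each potential used below contains the failure
  count, so that a failed request also counts as progress.\<close>

lemma avg_lists_drift:
  assumes U: "finite U" "U \<noteq> {}"
    and drift: "\<And>h. set h \<subseteq> U \<Longrightarrow> length h < t \<Longrightarrow>
      \<phi> h + c \<le> (\<Sum>k\<in>U. \<phi> (k # h)) / real (card U)"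
  shows "\<phi> [] + real t * c \<le> avg_lists U t \<phi>"
  using drift
proof (induction t)
  case (Suc t)
  have "\<phi> [] + real t * c + c \<le> avg_lists U t (\<lambda>h. \<phi> h) + avg_lists U t (\<lambda>_. c)"
    using Suc.IH Suc.prems U by (simp add: avg_lists_const)
  also have "\<dots> \<le> avg_lists U (Suc t) \<phi>"
    unfolding avg_lists_add [symmetric] avg_lists.simps
    by (rule avg_lists_mono) (simp add: Suc.prems)
  finally show ?case by (simp add: algebra_simps)
qed simp

text \<open>Exchanges the expectation over the random bits with the average over the adversary's
  keys. The latter is a nested finite sum, so linearity is enough.\<close>

lemma integral_avg_lists:
  assumes "\<And>h. set h \<subseteq> U \<Longrightarrow> length h = t \<Longrightarrow> integrable M (f h)"
  shows "integrable M (\<lambda>x. avg_lists U t (\<lambda>h. f h x)) \<and>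
    integral\<^sup>L M (\<lambda>x. avg_lists U t (\<lambda>h. f h x)) = avg_lists U t (\<lambda>h. integral\<^sup>L M (f h))"
  using assms
proof (induction t arbitrary: f)
  case (Suc t)
  have int: "integrable M (f (k # h))" if "set h \<subseteq> U" "length h = t" "k \<in> U" for h k
    using that by (intro Suc.prems) auto
  have "integrable M (\<lambda>x. (\<Sum>k\<in>U. f (k # h) x) / real (card U))"
    and eq: "integral\<^sup>L M (\<lambda>x. (\<Sum>k\<in>U. f (k # h) x) / real (card U))
      = (\<Sum>k\<in>U. integral\<^sup>L M (f (k # h))) / real (card U)"
    if "set h \<subseteq> U" "length h = t" for h
    using int [OF that] by (simp_all add: Bochner_Integration.integral_sum)
  from Suc.IH [OF this(1)] avg_lists_cong [OF eq]
  show ?case by simp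
qed simp

subsection \<open>Random insertions\<close>

primrec failures :: "('k list \<Rightarrow> 'k \<Rightarrow> bool) \<Rightarrow> 'k list \<Rightarrow> real" where
  "failures F [] = 0"
| "failures F (k # h) = failures F h + of_bool (F h k)"

lemma failures_nonneg: "0 \<le> failures F h"
  by (induction h) auto

lemma failures_append:
  "failures F (h' @ h) = failures F h + failures (\<lambda>h'. F (h' @ h)) h'"
  by (induction h') auto

text \<open>The table for one fixed outcome of its random bits: \<open>g\<close> dereferences,
  \<open>P\<close> contains the pointers, \<open>Occ h\<close> the slots occupied after the history
  \<open>h\<close>, and \<open>F h k\<close> says that \<open>k\<close> fails after
  \<open>h\<close>. The internal state enters only through \<open>Occ\<close> and
  \<open>F\<close>.\<close>

locale insertion_process =
  fixes U :: "'k set" and P :: "'p set" and n T :: nat and g :: "'k \<Rightarrow> 'p \<Rightarrow> nat"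
    and Occ :: "'k list \<Rightarrow> nat set" and F :: "'k list \<Rightarrow> 'k \<Rightarrow> bool"
  assumes finite_U: "finite U" and U_nonempty: "U \<noteq> {}"
    and finite_P: "finite P" and P_nonempty: "P \<noteq> {}"
    and n_pos: "0 < n"
    and Occ_less: "\<And>h. set h \<subseteq> U \<Longrightarrow> length h \<le> T \<Longrightarrow> Occ h \<subseteq> {..<n}"
    and Occ_fail: "\<And>h k. set h \<subseteq> U \<Longrightarrow> length h < T \<Longrightarrow> k \<in> U \<Longrightarrow> F h k \<Longrightarrow> Occ (k # h) = Occ h"
    and Occ_success: "\<And>h k. set h \<subseteq> U \<Longrightarrow> length h < T \<Longrightarrow> k \<in> U \<Longrightarrow> \<not> F h k \<Longrightarrow>
      \<exists>p\<in>P. g k p \<notin> Occ h \<and> g k p < n \<and> Occ (k # h) = insert (g k p) (Occ h)"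
begin

lemma card_U_pos: "0 < card U"
  using finite_U U_nonempty by (simp add: card_gt_0_iff)

lemma card_P_pos: "0 < card P"
  using finite_P P_nonempty by (simp add: card_gt_0_iff)

lemma Occ_mono_Cons:
  assumes "set h \<subseteq> U" "length h < T" "k \<in> U"
  shows "Occ h \<subseteq> Occ (k # h)"
  using Occ_fail [OF assms] Occ_success [OF assms] by (cases "F h k") auto

lemma Occ_mono_append:
  assumes "set h' \<subseteq> U" "set h \<subseteq> U" "length (h' @ h) \<le> T"
  shows "Occ h \<subseteq> Occ (h' @ h)"
  using assms
proof (induction h')
  case (Cons k h')
  then show ?case using Occ_mono_Cons [of "h' @ h" k] by fastforce
qed simp

lemma card_Occ:
  assumes "set h \<subseteq> U" "length h \<le> T"
  shows "real (card (Occ h)) = real (card (Occ [])) + real (length h) - failures F h"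
  using assms
proof (induction h)
  case (Cons k h)
  have h: "set h \<subseteq> U" "length h < T" "k \<in> U" using Cons.prems by auto
  have "finite (Occ h)"
    using Occ_less [of h] h by (auto intro: finite_subset)
  then show ?case
    using Cons.IH h Occ_fail [OF h] Occ_success [OF h] by (cases "F h k") auto
qed simp

section \<open>Blocked pointers and phases of insertions\<close>

definition num_blocked :: "'k list \<Rightarrow> 'k \<Rightarrow> nat" where
  "num_blocked h k = card {p \<in> P. g k p \<in> Occ h}"

lemma num_blocked_le: "num_blocked h k \<le> card P"
  unfolding num_blocked_def using finite_P by (intro card_mono) auto

lemma num_blocked_mono:
  assumes "set h' \<subseteq> U" "set h \<subseteq> U" "length (h' @ h) \<le> T"
  shows "num_blocked h k \<le> num_blocked (h' @ h) k"
  unfolding num_blocked_def using finite_P Occ_mono_append [OF assms]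
  by (intro card_mono) auto

text \<open>Double counting: each key that reaches \<open>R\<close> owns at least one pair mapped
  into \<open>R\<close>.\<close>

lemma few_light_keys:
  assumes "finite A" "finite R"
    and light: "\<And>v. v \<in> R \<Longrightarrow> real (card {x \<in> A \<times> P. g (fst x) (snd x) = v}) \<le> c"
  shows "real (card {k \<in> A. \<exists>p\<in>P. g k p \<in> R}) \<le> real (card R) * c"
proof -
  let ?X = "\<lambda>v. {x \<in> A \<times> P. g (fst x) (snd x) = v}"
  have fin: "finite (\<Union>v\<in>R. ?X v)"
    using assms finite_P by auto
  have "{k \<in> A. \<exists>p\<in>P. g k p \<in> R} \<subseteq> fst ` (\<Union>v\<in>R. ?X v)"
    by force
  then have "card {k \<in> A. \<exists>p\<in>P. g k p \<in> R} \<le> card (fst ` (\<Union>v\<in>R. ?X v))"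
    using fin by (intro card_mono) auto
  also have "\<dots> \<le> card (\<Union>v\<in>R. ?X v)"
    using fin by (rule card_image_le)
  also have "\<dots> \<le> (\<Sum>v\<in>R. card (?X v))"
    using assms by (intro card_UN_le) auto
  finally have "real (card {k \<in> A. \<exists>p\<in>P. g k p \<in> R}) \<le> (\<Sum>v\<in>R. real (card (?X v)))"
    by (simp flip: of_nat_sum)
  also have "\<dots> \<le> real (card R) * c"
    using light by (intro sum_bounded_above) auto
  finally show ?thesis .
qed

text \<open>Occupying \<open>v\<close> blocks exactly the pairs mapped to \<open>v\<close>. A key
  with several pointers to \<open>v\<close> is counted once per pointer, in agreement with
  \<open>num_blocked\<close>.\<close>

lemma sum_num_blocked:
  assumes "finite A" "Occ h' = insert v (Occ h)" "v \<notin> Occ h"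
  shows "(\<Sum>a\<in>A. real (num_blocked h' a))
    = (\<Sum>a\<in>A. real (num_blocked h a)) + real (card {x \<in> A \<times> P. g (fst x) (snd x) = v})"
proof -
  have split: "num_blocked h' a = num_blocked h a + card {p \<in> P. g a p = v}" for a
  proof -
    have "{p \<in> P. g a p \<in> Occ h'} = {p \<in> P. g a p \<in> Occ h} \<union> {p \<in> P. g a p = v}"
      using assms by auto
    then show ?thesis
      unfolding num_blocked_def using finite_P assms
      by (simp, subst card_Un_disjoint) auto
  qed
  have "{x \<in> A \<times> P. g (fst x) (snd x) = v} = (SIGMA a:A. {p \<in> P. g a p = v})"
    by auto
  then have "card {x \<in> A \<times> P. g (fst x) (snd x) = v} = (\<Sum>a\<in>A. card {p \<in> P. g a p = v})"
    using assms finite_P by simp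
  then show ?thesis
    by (simp add: split sum.distrib)
qed

text \<open>At least half of \<open>A\<close> has heavy slots only. Each such key either is served,
  which blocks more than \<open>card A / (2 * n)\<close> pairs, or fails, and then the last summand
  pays the same amount. The other keys do no harm, since blocking is monotone.\<close>

lemma blocked_step:
  assumes A: "A \<subseteq> U" and h: "set h \<subseteq> U" "length h < T"
  shows "(\<Sum>k\<in>U. (\<Sum>a\<in>A. real (num_blocked (k # h) a)) - (\<Sum>a\<in>A. real (num_blocked h a))
      + real (card A) / (2 * real n) * of_bool (F h k)) \<ge> (real (card A))\<^sup>2 / (4 * real n)"
    (is "(\<Sum>k\<in>U. ?gain k) \<ge> _")
proof -
  \<comment> \<open>With this threshold the light slots, at most \<open>n\<close> in number, are
    reached by at most half of \<open>A\<close>.\<close>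
  define c where "c = real (card A) / (2 * real n)"
  have c_nonneg: "0 \<le> c" by (simp add: c_def)
  have finA: "finite A" using A finite_U by (rule finite_subset)
  let ?q = "\<lambda>v. real (card {x \<in> A \<times> P. g (fst x) (snd x) = v})"
  define R where "R = {v. v < n \<and> ?q v \<le> c}"
  have finR: "finite R" and card_R: "card R \<le> n"
    using card_mono [of "{..<n}" R] by (auto simp: R_def)
  define B where "B = {k \<in> A. \<not> (\<exists>p\<in>P. g k p \<in> R)}"
  have "real (card {k \<in> A. \<exists>p\<in>P. g k p \<in> R}) \<le> real (card R) * c"
    using finA finR by (rule few_light_keys) (simp add: R_def)
  also have "\<dots> \<le> real n * c"
    using card_R c_nonneg by (intro mult_right_mono) auto
  also have "\<dots> = real (card A) / 2"
    using n_pos by (simp add: c_def)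
  moreover have "card A = card B + card {k \<in> A. \<exists>p\<in>P. g k p \<in> R}"
    unfolding B_def using finA by (subst card_Un_disjoint [symmetric]) (auto intro: arg_cong [where f = card])
  ultimately have card_B: "real (card B) \<ge> real (card A) / 2" by simp
  have gain_nonneg: "0 \<le> ?gain k" if "k \<in> U" for k
    using num_blocked_mono [of "[k]" h] that h c_nonneg
    by (auto intro!: sum_mono add_nonneg_nonneg)
  have gain: "c \<le> ?gain k" if "k \<in> B" for k
  proof -
    have k: "k \<in> U" using that A by (auto simp: B_def)
    show ?thesis
    proof (cases "F h k")
      case True
      then show ?thesis
        using Occ_fail [OF h k] by (simp add: num_blocked_def c_def)
    next
      case False
      then obtain p where p: "p \<in> P" "g k p \<notin> Occ h" "g k p < n"
        "Occ (k # h) = insert (g k p) (Occ h)"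
        using Occ_success [OF h k] by blast
      then have "?q (g k p) > c"
        using that by (auto simp: B_def R_def)
      then show ?thesis
        using False sum_num_blocked [OF finA p(4,2)] by simp
    qed
  qed
  have "(real (card A))\<^sup>2 / (4 * real n) = real (card A) / 2 * c"
    by (simp add: c_def power2_eq_square)
  also have "\<dots> \<le> real (card B) * c"
    using card_B c_nonneg by (intro mult_right_mono)
  also have "\<dots> = (\<Sum>k\<in>B. c)" by simp
  also have "\<dots> \<le> (\<Sum>k\<in>B. ?gain k)"
    by (intro sum_mono gain)
  also have "\<dots> \<le> (\<Sum>k\<in>U. ?gain k)"
    using finite_U A gain_nonneg by (intro sum_mono2) (auto simp: B_def)
  finally show ?thesis .
qed

definition blocked_fraction :: "nat \<Rightarrow> 'k list \<Rightarrow> real" where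
  "blocked_fraction j h = real (card {k \<in> U. j \<le> num_blocked h k}) / real (card U)"

lemma blocked_fraction_le_1: "blocked_fraction j h \<le> 1"
  unfolding blocked_fraction_def using finite_U card_U_pos
  by (simp add: divide_le_eq_1 card_mono)

lemma blocked_fraction_nonneg: "0 \<le> blocked_fraction j h"
  by (simp add: blocked_fraction_def)

lemma blocked_fraction_0: "blocked_fraction 0 h = 1"
  using card_U_pos by (simp add: blocked_fraction_def)

text \<open>\<open>blocked_step\<close> is summed over \<open>L\<close> insertions with
  \<open>A\<close> frozen as the keys having \<open>j\<close> blocked pointers at the start. A key
  of \<open>A\<close> whose count grows ends with at least \<open>j + 1\<close> blocked pointers,
  and its count grows by at most \<open>card P\<close>; so the total growth bounds the next fraction
  from below.\<close>

lemma phase: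
  assumes h0: "set h0 \<subseteq> U" "length h0 + L \<le> T"
  shows "real L / (4 * real n) * (blocked_fraction j h0)\<^sup>2 \<le>
    real (card P) * avg_lists U L (\<lambda>h. blocked_fraction (Suc j) (h @ h0))
    + 1 / (2 * real n) * avg_lists U L (\<lambda>h. failures F (h @ h0) - failures F h0)"
proof -
  define N where "N = real (card U)"
  have N: "N > 0" using card_U_pos by (simp add: N_def)
  define A where "A = {k \<in> U. j \<le> num_blocked h0 k}"
  define f where "f = blocked_fraction j h0"
  have A: "A \<subseteq> U" and cardA: "real (card A) = f * N"
    using N by (auto simp: A_def f_def N_def blocked_fraction_def)
  have f: "0 \<le> f" "f \<le> 1"
    by (simp_all add: f_def blocked_fraction_nonneg blocked_fraction_le_1)
  define S where "S = (\<lambda>h. \<Sum>a\<in>A. real (num_blocked h a))"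
  define e where "e = f * N / (2 * real n)"
  \<comment> \<open>Normalised to vanish at the start of the phase; \<open>e\<close> equals
    \<open>card A / (2 * n)\<close>, the price of a failure in \<open>blocked_step\<close>.\<close>
  define \<phi> where "\<phi> = (\<lambda>h. S (h @ h0) - S h0 + e * (failures F (h @ h0) - failures F h0))"
  have drift: "\<phi> h + f\<^sup>2 * N / (4 * real n) \<le> (\<Sum>k\<in>U. \<phi> (k # h)) / N"
    if h: "set h \<subseteq> U" "length h < L" for h
  proof -
    have "(f * N)\<^sup>2 / (4 * real n) \<le> (\<Sum>k\<in>U. S (k # h @ h0) - S (h @ h0)
        + e * of_bool (F (h @ h0) k))"
      using blocked_step [OF A, of "h @ h0"] h h0 cardA by (simp add: S_def e_def)
    also have "\<dots> = (\<Sum>k\<in>U. \<phi> (k # h) - \<phi> h)"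
      by (intro sum.cong) (auto simp: \<phi>_def algebra_simps)
    also have "\<dots> = (\<Sum>k\<in>U. \<phi> (k # h)) - N * \<phi> h"
      by (simp add: sum_subtractf N_def)
    finally show ?thesis
      using N by (simp add: field_simps power2_eq_square)
  qed
  have "\<phi> [] + real L * (f\<^sup>2 * N / (4 * real n)) \<le> avg_lists U L \<phi>"
    using finite_U U_nonempty drift unfolding N_def by (rule avg_lists_drift)
  then have "real L * (f\<^sup>2 * N / (4 * real n)) \<le> avg_lists U L \<phi>"
    by (simp add: \<phi>_def)
  also have "\<dots> \<le> avg_lists U L (\<lambda>h. N * (real (card P) * blocked_fraction (Suc j) (h @ h0)
      + 1 / (2 * real n) * (failures F (h @ h0) - failures F h0)))"
  proof (rule avg_lists_mono)
    fix h assume h: "set h \<subseteq> U" "length h = L"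
    have "S (h @ h0) - S h0 = (\<Sum>a\<in>A. real (num_blocked (h @ h0) a) - real (num_blocked h0 a))"
      by (simp add: S_def sum_subtractf)
    also have "\<dots> \<le> (\<Sum>a\<in>A. real (card P) * of_bool (Suc j \<le> num_blocked (h @ h0) a))"
    proof (rule sum_mono)
      fix a assume "a \<in> A"
      then have "j \<le> num_blocked h0 a" by (simp add: A_def)
      then show "real (num_blocked (h @ h0) a) - real (num_blocked h0 a)
          \<le> real (card P) * of_bool (Suc j \<le> num_blocked (h @ h0) a)"
        using num_blocked_le [of "h @ h0" a] by (auto simp: of_bool_def)
    qed
    also have "\<dots> \<le> (\<Sum>a\<in>U. real (card P) * of_bool (Suc j \<le> num_blocked (h @ h0) a))"
      using A finite_U by (intro sum_mono2) auto
    also have "\<dots> = real (card P) * real (card {a \<in> U. Suc j \<le> num_blocked (h @ h0) a})"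
      by (simp only: sum_distrib_left [symmetric] sum_of_bool_eq [OF finite_U finite_U] Collect_conj_eq Collect_mem_eq)
    also have "\<dots> = N * (real (card P) * blocked_fraction (Suc j) (h @ h0))"
      using N by (simp add: blocked_fraction_def N_def)
    finally have 1: "S (h @ h0) - S h0 \<le> N * (real (card P) * blocked_fraction (Suc j) (h @ h0))" .
    have "f * (N / (2 * real n) * (failures F (h @ h0) - failures F h0))
        \<le> 1 * (N / (2 * real n) * (failures F (h @ h0) - failures F h0))"
      using f N by (intro mult_right_mono) (auto simp: failures_append failures_nonneg)
    then have "e * (failures F (h @ h0) - failures F h0)
        \<le> N * (1 / (2 * real n) * (failures F (h @ h0) - failures F h0))"
      by (simp add: e_def mult_ac)
    with 1 show "\<phi> h \<le> N * (real (card P) * blocked_fraction (Suc j) (h @ h0)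
      + 1 / (2 * real n) * (failures F (h @ h0) - failures F h0))"
      unfolding \<phi>_def distrib_left by linarith
  qed
  also have "\<dots> = N * (real (card P) * avg_lists U L (\<lambda>h. blocked_fraction (Suc j) (h @ h0))
      + 1 / (2 * real n) * avg_lists U L (\<lambda>h. failures F (h @ h0) - failures F h0))"
    by (simp only: avg_lists_cmult avg_lists_add)
  also have "real L * (f\<^sup>2 * N / (4 * real n)) = N * (real L / (4 * real n) * f\<^sup>2)"
    by simp
  finally show ?thesis
    using N unfolding f_def by (rule mult_left_le_imp_le)
qed

lemma all_blocked_imp_fail:
  assumes h: "set h \<subseteq> U" "length h < T" "k \<in> U" and "card P \<le> num_blocked h k"
  shows "F h k"
proof (rule ccontr)
  assume "\<not> F h k"
  then obtain p where p: "p \<in> P" "g k p \<notin> Occ h"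
    using Occ_success [OF h] by blast
  then have "{p \<in> P. g k p \<in> Occ h} \<subset> P" by auto
  then have "num_blocked h k < card P"
    unfolding num_blocked_def using finite_P by (rule psubset_card_mono [rotated])
  with assms show False by simp
qed

text \<open>Keys with all pointers blocked at the start remain so, hence every later request for one
  of them fails.\<close>

lemma last_phase:
  assumes h0: "set h0 \<subseteq> U" "length h0 + L \<le> T"
  shows "real L * blocked_fraction (card P) h0
    \<le> avg_lists U L (\<lambda>h. failures F (h @ h0) - failures F h0)"
proof -
  define \<phi> where "\<phi> = (\<lambda>h. failures F (h @ h0) - failures F h0)"
  have "\<phi> [] + real L * blocked_fraction (card P) h0 \<le> avg_lists U L \<phi>"
  proof (rule avg_lists_drift)
    fix h assume h: "set h \<subseteq> U" "length h < L"
    let ?X = "{k \<in> U. card P \<le> num_blocked h0 k}"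
    have "real (card ?X) = (\<Sum>k\<in>?X. 1)" by simp
    also have "\<dots> \<le> (\<Sum>k\<in>?X. of_bool (F (h @ h0) k))"
    proof (rule sum_mono)
      fix k assume "k \<in> ?X"
      then have "F (h @ h0) k"
        using h h0 num_blocked_mono [of h h0 k]
        by (intro all_blocked_imp_fail) auto
      then show "1 \<le> (of_bool (F (h @ h0) k) :: real)" by simp
    qed
    also have "\<dots> \<le> (\<Sum>k\<in>U. of_bool (F (h @ h0) k))"
      using finite_U by (intro sum_mono2) auto
    also have "\<dots> = (\<Sum>k\<in>U. \<phi> (k # h) - \<phi> h)"
      by (simp add: \<phi>_def)
    also have "\<dots> = (\<Sum>k\<in>U. \<phi> (k # h)) - real (card U) * \<phi> h"
      by (simp add: sum_subtractf)
    finally show "\<phi> h + blocked_fraction (card P) h0 \<le> (\<Sum>k\<in>U. \<phi> (k # h)) / real (card U)"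
      using card_U_pos
      by (simp add: blocked_fraction_def pos_le_divide_eq algebra_simps)
  qed (fact finite_U U_nonempty)+
  then show ?thesis by (simp add: \<phi>_def)
qed

text \<open>\<open>card P\<close> phases raise the number of blocked pointers from 0 to
  \<open>card P\<close>, and one further phase turns fully blocked keys into failures.\<close>

lemma avg_failures_lower_bound:
  assumes T: "T = Suc (card P) * L" and L: "L \<le> n"
  shows "real L / 4 * (real L / (8 * real n * real (card P))) ^ 2 ^ Suc (card P)
    \<le> avg_lists U T (failures F)"
proof -
  define d where "d = card P"
  define X where "X = avg_lists U T (failures F)"
  \<comment> \<open>Half of the coefficient \<open>L / (4 * n * d)\<close> in the recursion for
    \<open>\<beta>\<close>; the other half is reserved for the failure term.\<close>
  define \<gamma> where "\<gamma> = real L / (8 * real n * real d)"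
  define \<beta> where "\<beta> = (\<lambda>j. avg_lists U (j * L) (blocked_fraction j))"
  have d: "1 \<le> real d" using card_P_pos by (simp add: d_def)
  have \<gamma>: "0 \<le> \<gamma>" "\<gamma> \<le> 1"
  proof -
    have "real L \<le> 8 * real n * real d"
      using mult_mono [of "real L" "8 * real n" 1 "real d"] d L by auto
    then show "0 \<le> \<gamma>" "\<gamma> \<le> 1"
      using n_pos d by (auto simp: \<gamma>_def)
  qed
  \<comment> \<open>A function of the older keys keeps its mean when newer keys are added;
    \<open>drop u\<close> removes the \<open>u\<close> newest ones.\<close>
  have avg_le: "avg_lists U t (failures F) \<le> avg_lists U (t + u) (failures F)" for t u
  proof -
    have "avg_lists U t (failures F) = avg_lists U (t + u) (\<lambda>h. failures F (drop u h))"
      unfolding avg_lists_append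
    proof (rule avg_lists_cong)
      fix h
      have "avg_lists U u (\<lambda>h'. failures F (drop u (h' @ h))) = avg_lists U u (\<lambda>_. failures F h)"
        by (rule avg_lists_cong) simp
      then show "failures F h = avg_lists U u (\<lambda>h'. failures F (drop u (h' @ h)))"
        by (simp add: avg_lists_const finite_U U_nonempty)
    qed
    also have "\<dots> \<le> avg_lists U (t + u) (failures F)"
    proof (rule avg_lists_mono)
      fix h
      show "failures F (drop u h) \<le> failures F h"
        using failures_append [of F "take u h" "drop u h"] by (simp add: failures_nonneg)
    qed
    finally show ?thesis .
  qed
  have phase_failures: "avg_lists U t (\<lambda>h0. avg_lists U L (\<lambda>h. failures F (h @ h0) - failures F h0)) \<le> X"
    if "t + L \<le> T" for t
  proof -
    have "avg_lists U t (\<lambda>h0. avg_lists U L (\<lambda>h. failures F (h @ h0) - failures F h0))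
        = avg_lists U (t + L) (failures F) - avg_lists U t (failures F)"
      by (simp add: avg_lists_append avg_lists_diff avg_lists_const finite_U U_nonempty)
    also have "\<dots> \<le> avg_lists U (t + L) (failures F)"
    proof -
      have "avg_lists U t (\<lambda>_. 0) \<le> avg_lists U t (failures F)"
        by (intro avg_lists_mono failures_nonneg)
      then show ?thesis by (simp only: avg_lists_const [OF finite_U U_nonempty])
    qed
    also have "\<dots> \<le> X"
      using avg_le [of "t + L" "T - (t + L)"] that by (simp add: X_def)
    finally show ?thesis .
  qed
  \<comment> \<open>Jensen replaces the mean of the squared fraction by the square of its mean, so
    that only the numbers \<open>\<beta> j\<close> remain.\<close>
  have step: "real L / (4 * real n) * (\<beta> j)\<^sup>2 \<le> real d * \<beta> (Suc j) + 1 / (2 * real n) * X"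
    if j: "j < d" for j
  proof -
    have "j * L + L \<le> T"
      using mult_right_mono [of "Suc j" "Suc (card P)" L] j by (simp add: T d_def)
    have "real L / (4 * real n) * (\<beta> j)\<^sup>2
        \<le> real L / (4 * real n) * avg_lists U (j * L) (\<lambda>h. (blocked_fraction j h)\<^sup>2)"
      unfolding \<beta>_def using avg_lists_jensen_square [OF finite_U U_nonempty]
      by (intro mult_left_mono) auto
    also have "\<dots> = avg_lists U (j * L) (\<lambda>h. real L / (4 * real n) * (blocked_fraction j h)\<^sup>2)"
      by (rule avg_lists_cmult [symmetric])
    also have "\<dots> \<le> avg_lists U (j * L) (\<lambda>h0.
        real d * avg_lists U L (\<lambda>h. blocked_fraction (Suc j) (h @ h0))
        + 1 / (2 * real n) * avg_lists U L (\<lambda>h. failures F (h @ h0) - failures F h0))"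
      unfolding d_def using \<open>j * L + L \<le> T\<close> by (intro avg_lists_mono phase) auto
    also have "\<dots> = real d * \<beta> (Suc j) + 1 / (2 * real n) *
        avg_lists U (j * L) (\<lambda>h0. avg_lists U L (\<lambda>h. failures F (h @ h0) - failures F h0))"
    proof -
      have "\<beta> (Suc j) = avg_lists U (j * L + L) (blocked_fraction (Suc j))"
        by (simp add: \<beta>_def add.commute)
      also have "\<dots> = avg_lists U (j * L) (\<lambda>h0. avg_lists U L (\<lambda>h. blocked_fraction (Suc j) (h @ h0)))"
        by (rule avg_lists_append)
      finally show ?thesis
        by (simp only: avg_lists_add avg_lists_cmult)
    qed
    also have "\<dots> \<le> real d * \<beta> (Suc j) + 1 / (2 * real n) * X"
      using phase_failures [OF \<open>j * L + L \<le> T\<close>] by (intro add_left_mono mult_left_mono) auto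
    finally show ?thesis .
  qed
  have last: "real L * \<beta> d \<le> X"
  proof -
    have "real L * \<beta> d = avg_lists U (d * L) (\<lambda>h0. real L * blocked_fraction d h0)"
      by (simp add: \<beta>_def avg_lists_cmult)
    also have "\<dots> \<le> avg_lists U (d * L) (\<lambda>h0. avg_lists U L (\<lambda>h. failures F (h @ h0) - failures F h0))"
      unfolding d_def by (intro avg_lists_mono last_phase) (auto simp: T)
    also have "\<dots> \<le> X"
      by (rule phase_failures) (simp add: T d_def)
    finally show ?thesis .
  qed
  \<comment> \<open>The solution of \<open>y (Suc j) = \<gamma> * (y j)\<^sup>2\<close> with
    \<open>y 0 = 1\<close>.\<close>
  define y where "y = (\<lambda>j::nat. \<gamma> ^ (2 ^ j - 1))"
  have y_Suc: "y (Suc j) = \<gamma> * (y j)\<^sup>2" for j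
  proof -
    have "2 ^ Suc j - 1 = Suc ((2 ^ j - 1) * 2 :: nat)"
      by (cases "2 ^ j :: nat") auto
    then show ?thesis
      by (simp only: y_def power_Suc power_mult)
  qed
  have y_nonneg: "0 \<le> y j" for j using \<gamma> by (simp add: y_def)
  have y_antimono: "y d \<le> y j" if "j \<le> d" for j
    unfolding y_def using \<gamma> that
    by (intro power_decreasing diff_le_mono power_increasing) auto
  \<comment> \<open>If \<open>X\<close> were smaller, failures would consume at most half of the
    gain in each phase, so \<open>\<beta>\<close> would stay above \<open>y\<close>. The last phase
    would then yield at least \<open>L * y d\<close> failures, which is too many.\<close>
  have "real L / 4 * (y d)\<^sup>2 \<le> X"
  proof (rule ccontr)
    assume "\<not> ?thesis"
    then have X: "X < real L / 4 * (y d)\<^sup>2" by simp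
    have "y j \<le> \<beta> j" if "j \<le> d" for j
      using that
    proof (induction j)
      case 0
      show ?case by (simp add: y_def \<beta>_def blocked_fraction_0)
    next
      case (Suc j)
      have "X \<le> real L / 4 * (y j)\<^sup>2"
        using X mult_left_mono [OF power_mono [OF y_antimono y_nonneg], of j "real L / 4" 2] Suc.prems
        by auto
      then have "1 / (2 * real n) * X \<le> 1 / (2 * real n) * (real L / 4 * (y j)\<^sup>2)"
        by (intro mult_left_mono) auto
      also have "\<dots> = real d * (\<gamma> * (y j)\<^sup>2)"
        using d by (simp add: \<gamma>_def power2_eq_square)
      finally have 1: "1 / (2 * real n) * X \<le> real d * (\<gamma> * (y j)\<^sup>2)" .
      have "2 * (real d * (\<gamma> * (y j)\<^sup>2)) = real L / (4 * real n) * (y j)\<^sup>2"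
        using d by (simp add: \<gamma>_def)
      also have "\<dots> \<le> real L / (4 * real n) * (\<beta> j)\<^sup>2"
        using Suc y_nonneg by (intro mult_left_mono power_mono) auto
      also have "\<dots> \<le> real d * \<beta> (Suc j) + 1 / (2 * real n) * X"
        using step Suc.prems by simp
      finally have "real d * y (Suc j) \<le> real d * \<beta> (Suc j)"
        using 1 unfolding y_Suc by linarith
      then show ?case using d by simp
    qed
    then have "real L * y d \<le> real L * \<beta> d"
      by (intro mult_left_mono) auto
    with last have "real L * y d \<le> X" by simp
    moreover have "real L / 4 * (y d)\<^sup>2 \<le> real L * y d"
    proof -
      have "y d \<le> 1" using \<gamma> by (simp add: y_def power_le_one)
      then have "y d * y d \<le> 4 * y d"
        using y_nonneg [of d] by (intro mult_right_mono) auto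
      then have "real L * (y d * y d) \<le> real L * (4 * y d)"
        by (rule mult_left_mono) simp
      then show ?thesis by (simp add: power2_eq_square)
    qed
    ultimately show False using X by simp
  qed
  moreover have "\<gamma> ^ 2 ^ Suc d \<le> (y d)\<^sup>2"
    unfolding y_def power_mult [symmetric] using \<gamma>
    by (intro power_decreasing) (auto simp: diff_mult_distrib)
  then have "real L / 4 * \<gamma> ^ 2 ^ Suc d \<le> real L / 4 * (y d)\<^sup>2"
    by (rule mult_left_mono) simp
  ultimately show ?thesis
    by (simp add: X_def \<gamma>_def d_def)
qed

section \<open>Heavy slots and the shortage of free slots\<close>

definition heavy_slots :: "real \<Rightarrow> nat set" where
  "heavy_slots r = {v. v < n \<and> real (card U) < 2 * r * real (card {x \<in> U \<times> P. g (fst x) (snd x) = v})}"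

text \<open>The pairs mapped to different slots are disjoint subsets of \<open>U \<times> P\<close>.
  The threshold \<open>card U / (2 * r)\<close> is such that \<open>r\<close> light slots are
  reached by at most half of the universe.\<close>

lemma card_heavy_slots:
  assumes "0 < r"
  shows "real (card (heavy_slots r)) \<le> 2 * r * real (card P)"
proof -
  let ?X = "\<lambda>v. {x \<in> U \<times> P. g (fst x) (snd x) = v}"
  have fin: "finite (heavy_slots r)" by (simp add: heavy_slots_def)
  have "real (card (heavy_slots r)) * real (card U) = (\<Sum>v\<in>heavy_slots r. real (card U))"
    by simp
  also have "\<dots> \<le> (\<Sum>v\<in>heavy_slots r. 2 * r * real (card (?X v)))"
    by (intro sum_mono) (auto simp: heavy_slots_def)
  also have "\<dots> = 2 * r * real (\<Sum>v\<in>heavy_slots r. card (?X v))"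
    by (simp add: sum_distrib_left)
  also have "(\<Sum>v\<in>heavy_slots r. card (?X v)) = card (\<Union>v\<in>heavy_slots r. ?X v)"
    using fin finite_U finite_P by (intro card_UN_disjoint [symmetric]) auto
  also have "2 * r * real (card (\<Union>v\<in>heavy_slots r. ?X v)) \<le> 2 * r * real (card (U \<times> P))"
    using fin finite_U finite_P assms by (intro mult_left_mono of_nat_mono card_mono) auto
  also have "\<dots> = 2 * r * real (card P) * real (card U)"
    by (simp add: card_cartesian_product)
  finally show ?thesis using card_U_pos by simp
qed

text \<open>Free light slots never number more than the free slots at the start, so a fixed fraction
  of the keys cannot use them. Each request for such a key either fails or consumes a free heavy
  slot; the potential is failures minus free heavy slots.\<close>

lemma heavy_exhaustion:
  assumes r: "0 < r"
  shows "real T * (1 - real (n - card (Occ [])) / (2 * r))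
    \<le> real (card (heavy_slots r - Occ [])) + avg_lists U T (failures F)"
proof -
  define N where "N = real (card U)"
  have N: "0 < N" using card_U_pos by (simp add: N_def)
  let ?H = "heavy_slots r"
  define c where "c = 1 - real (n - card (Occ [])) / (2 * r)"
  define \<phi> where "\<phi> = (\<lambda>h. failures F h - real (card (?H - Occ h)))"
  have finH: "finite ?H" by (simp add: heavy_slots_def)
  have "\<phi> [] + real T * c \<le> avg_lists U T \<phi>"
  proof (rule avg_lists_drift)
    fix h assume h: "set h \<subseteq> U" "length h < T"
    \<comment> \<open>\<open>R\<close> contains the free light slots and \<open>B\<close> the keys
      that one of them could serve.\<close>
    define R where "R = {..<n} - Occ h - ?H"
    define B where "B = {k \<in> U. \<exists>p\<in>P. g k p \<in> R}"
    have finR: "finite R" by (simp add: R_def)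
    have finO: "finite (Occ [])" "Occ [] \<subseteq> Occ h" "Occ h \<subseteq> {..<n}"
      using Occ_less [of "[]"] Occ_less [of h] Occ_mono_append [of h "[]"] h
      by (auto intro: finite_subset)
    have "card R \<le> card ({..<n} - Occ [])"
      using finO by (intro card_mono) (auto simp: R_def)
    also have "\<dots> = n - card (Occ [])"
      using finO by (subst card_Diff_subset) auto
    finally have cardR: "card R \<le> n - card (Occ [])" .
    have "real (card B) \<le> real (card R) * (N / (2 * r))"
      unfolding B_def using finite_U finR
    proof (rule few_light_keys)
      fix v assume "v \<in> R"
      then show "real (card {x \<in> U \<times> P. g (fst x) (snd x) = v}) \<le> N / (2 * r)"
        using r by (auto simp: R_def heavy_slots_def N_def field_simps)
    qed
    also have "\<dots> \<le> real (n - card (Occ [])) * (N / (2 * r))"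
      using cardR r N by (intro mult_right_mono) auto
    also have "\<dots> = N * (1 - c)" by (simp add: c_def)
    finally have cardB: "real (card B) \<le> N * (1 - c)" .
    have "N * c \<le> real (card U) - real (card B)"
      using cardB by (simp add: N_def algebra_simps)
    also have "\<dots> = real (card (U - B))"
      using card_mono [OF finite_U, of B] finite_U
      by (subst card_Diff_subset) (auto simp: B_def)
    also have "\<dots> = (\<Sum>k\<in>U - B. 1)" by simp
    also have "\<dots> \<le> (\<Sum>k\<in>U - B. \<phi> (k # h) - \<phi> h)"
    proof (rule sum_mono)
      fix k assume k: "k \<in> U - B"
      show "1 \<le> \<phi> (k # h) - \<phi> h"
      proof (cases "F h k")
        case True
        then show ?thesis using Occ_fail [OF h] k by (simp add: \<phi>_def)
      next
        case False
        then obtain p where p: "p \<in> P" "g k p \<notin> Occ h" "g k p < n"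
          "Occ (k # h) = insert (g k p) (Occ h)"
          using Occ_success [OF h] k by blast
        then have "g k p \<in> ?H - Occ h"
          using k by (auto simp: B_def R_def)
        moreover have "?H - Occ (k # h) = (?H - Occ h) - {g k p}"
          using p by auto
        ultimately have "card (?H - Occ h) = Suc (card (?H - Occ (k # h)))"
          using finH card.remove [of "?H - Occ h" "g k p"] by simp
        then show ?thesis using False by (simp add: \<phi>_def)
      qed
    qed
    also have "\<dots> \<le> (\<Sum>k\<in>U. \<phi> (k # h) - \<phi> h)"
    proof (rule sum_mono2)
      fix k assume "k \<in> U - (U - B)"
      then have "Occ h \<subseteq> Occ (k # h)" using Occ_mono_Cons h by auto
      then have "card (?H - Occ (k # h)) \<le> card (?H - Occ h)"
        using finH by (intro card_mono) auto
      then show "0 \<le> \<phi> (k # h) - \<phi> h" by (simp add: \<phi>_def)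
    qed (use finite_U in auto)
    also have "\<dots> = (\<Sum>k\<in>U. \<phi> (k # h)) - N * \<phi> h"
      by (simp add: sum_subtractf N_def)
    finally show "\<phi> h + c \<le> (\<Sum>k\<in>U. \<phi> (k # h)) / real (card U)"
      using N unfolding N_def [symmetric] by (simp add: pos_le_divide_eq algebra_simps)
  qed (fact finite_U U_nonempty)+
  also have "\<dots> \<le> avg_lists U T (failures F)"
    by (rule avg_lists_mono) (simp add: \<phi>_def)
  finally show ?thesis by (simp add: \<phi>_def c_def)
qed

end

subsection \<open>Execution of request sequences\<close>

text \<open>Mirrors the live set threaded through \<open>admissible_from\<close>, in which failed
  allocations count as live.\<close>

fun live :: "'k set \<Rightarrow> 'k request list \<Rightarrow> 'k set" where
  "live L [] = L"
| "live L (Allocate k # rs) = live (insert k L) rs"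
| "live L (Free k # rs) = live (L - {k}) rs"

lemma live_append: "live L (rs @ rs') = live (live L rs) rs'"
  by (induction L rs rule: live.induct) auto

lemma live_Allocate: "live L (map Allocate ks) = L \<union> set ks"
  by (induction ks arbitrary: L) auto

lemma live_Free: "live L (map Free ks) = L - set ks"
  by (induction ks arbitrary: L) auto

lemma admissible_from_append:
  "admissible_from U c L (rs @ rs') \<longleftrightarrow>
    admissible_from U c L rs \<and> admissible_from U c (live L rs) rs'"
  by (induction L rs rule: live.induct) auto

lemma admissible_from_Free:
  assumes "set ks \<subseteq> L" "distinct ks"
  shows "admissible_from U c L (map Free ks)"
  using assms
proof (induction ks arbitrary: L)
  case (Cons k ks)
  then have "set ks \<subseteq> L - {k}" by auto
  with Cons show ?case by simp
qed simp

lemma pointers_snoc: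
  "pointers D n q w (rs @ [r]) = snd (step D w (execute D n q w rs) r)"
  by (simp add: pointers_def execute_def)

lemma pointers_Allocate:
  "pointers D n q w (rs @ [Allocate k])
    = (pointers D n q w rs)(k := pointers D n q w (rs @ [Allocate k]) k)"
  unfolding pointers_snoc
  by (cases "execute D n q w rs") (auto simp: pointers_def split: prod.splits)

lemma pointers_Free:
  "pointers D n q w (rs @ [Free k]) = (pointers D n q w rs)(k := None)"
  unfolding pointers_snoc
  by (cases "execute D n q w rs") (auto simp: pointers_def split: option.splits)

lemma pointers_Frees:
  "pointers D n q w (rs @ map Free ks) = (pointers D n q w rs) |` (- set ks)"
proof (induction ks rule: rev_induct)
  case (snoc k ks)
  show ?case
    using pointers_Free [of D n q w "rs @ map Free ks" k] snoc
    by (auto simp: restrict_map_def fun_eq_iff)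
qed simp

lemma dom_pointers_subset_live: "dom (pointers D n q w rs) \<subseteq> live {} rs"
proof (induction rs rule: rev_induct)
  case Nil
  show ?case by (simp add: pointers_def execute_def)
next
  case (snoc r rs)
  show ?case
  proof (cases r)
    case (Allocate k)
    then have "dom (pointers D n q w (rs @ [r])) \<subseteq> insert k (dom (pointers D n q w rs))"
      using pointers_Allocate [of D n q w rs k] by (auto simp: fun_eq_iff split: if_splits)
    then show ?thesis using snoc Allocate by (auto simp: live_append)
  next
    case (Free k)
    then show ?thesis using snoc pointers_Free [of D n q w rs k]
      by (auto simp: live_append split: if_splits)
  qed
qed

definition occupied :: "('k \<Rightarrow> 'p \<Rightarrow> nat) \<Rightarrow> ('k \<rightharpoonup> 'p) \<Rightarrow> nat set" where
  "occupied g m = {g k p | k p. m k = Some p}"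

lemma occupied_update:
  assumes "m k = None"
  shows "occupied g (m(k \<mapsto> p)) = insert (g k p) (occupied g m)"
  using assms by (auto simp: occupied_def) (metis option.distinct(1))

text \<open>Histories of keys are stored newest first, so that \<^const>\<open>remdups\<close> keeps the oldest occurrence
  of every key. A key that was already requested, or that lies in \<open>E\<close>, is not requested again.\<close>

definition insertions :: "'k request list \<Rightarrow> 'k set \<Rightarrow> 'k list \<Rightarrow> 'k request list" where
  "insertions rs E h = rs @ map Allocate (rev (remdups (filter (\<lambda>k. k \<notin> E) h)))"

lemma insertions_Nil: "insertions rs E [] = rs"
  by (simp add: insertions_def)

lemma insertions_Cons:
  "insertions rs E (k # h) =
    (if k \<in> E \<union> set h then insertions rs E h else insertions rs E h @ [Allocate k])"
  by (simp add: insertions_def)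

lemma live_insertions: "live {} (insertions rs E h) = live {} rs \<union> (set h - E)"
  by (auto simp: insertions_def live_append live_Allocate)

section \<open>A table with short pointers for one fixed number of slots\<close>

locale fixed_size_table = prob_space M
  for M :: "'w measure" +
  fixes D :: "('w, 'k, 's) deref_table" and U :: "'k set" and c \<epsilon> :: real and n q s :: nat
  assumes finite_U: "finite U" and U_nonempty: "U \<noteq> {}" and n_pos: "0 < n"
    and \<epsilon>_nonneg: "0 \<le> \<epsilon>"
    and correct: "correct_slots M D n q U c"
    and failure: "failure_bounded M D n q U c \<epsilon>"
    and short: "\<And>rs w k p. admissible U c rs \<Longrightarrow> w \<in> space M \<Longrightarrow>
      pointers D n q w rs k = Some p \<Longrightarrow> length p \<le> s"
begin

definition short_pointers :: "tiny_pointer set" where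
  "short_pointers = {p. length p \<le> s}"

lemma finite_short_pointers: "finite short_pointers"
  using finite_lists_length_le [of "UNIV :: bool set" s] by (simp add: short_pointers_def)

lemma short_pointers_nonempty: "short_pointers \<noteq> {}"
  by (auto simp: short_pointers_def intro: exI [of _ "[]"])

lemma card_short_pointers: "card short_pointers \<le> 2 ^ Suc s"
proof -
  have "card short_pointers = (\<Sum>i\<le>s. 2 ^ i)"
    using card_lists_length_le [of "UNIV :: bool set" s]
    by (simp add: short_pointers_def card_UNIV_bool)
  also have "\<dots> = 2 ^ Suc s - 1"
    by (induction s) auto
  finally show ?thesis by simp
qed

abbreviation slots :: "'w \<Rightarrow> 'k request list \<Rightarrow> nat set" where
  "slots w rs \<equiv> occupied (dereference D w n) (pointers D n q w rs)"

text \<open>A repeated or excluded key is skipped by \<open>insertions\<close> and leaves the slots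
  unchanged, so it is charged as a failure. In a large universe this is rare.\<close>

definition unserved :: "'k request list \<Rightarrow> 'k set \<Rightarrow> 'w \<Rightarrow> 'k list \<Rightarrow> 'k \<Rightarrow> bool" where
  "unserved rs E w h k \<longleftrightarrow> k \<in> E \<union> set h \<or>
    pointers D n q w (insertions rs E h @ [Allocate k]) k = None"

lemma slots_less:
  assumes "admissible U c rs" "w \<in> space M"
  shows "slots w rs \<subseteq> {..<n}"
  using correct assms unfolding correct_slots_def occupied_def by auto

text \<open>A starting point for \<open>T\<close> insertions. Keys outside \<open>E\<close> are
  fresh; \<open>E\<close> may also contain keys already freed. The strict bound is needed for each
  \<open>t\<close>, because capacity is tested before each allocation.\<close>

definition base :: "'k request list \<Rightarrow> 'k set \<Rightarrow> nat \<Rightarrow> bool" where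
  "base rs E T \<longleftrightarrow> admissible U c rs \<and> live {} rs \<subseteq> E \<and> finite E
    \<and> (\<forall>t<T. real (card (live {} rs) + t) < c)"

lemma insertions_admissible:
  assumes base: "base rs E T" and "set h \<subseteq> U" "length h \<le> T"
  shows "admissible U c (insertions rs E h)"
  using assms(2-)
proof (induction h)
  case Nil
  show ?case using base by (simp add: insertions_Nil base_def)
next
  case (Cons k h)
  have "live {} rs \<subseteq> E" "finite (live {} rs)"
    using base by (auto simp: base_def intro: finite_subset)
  have "card (live {} (insertions rs E h)) \<le> card (live {} rs) + card (set h - E)"
    unfolding live_insertions by (rule card_Un_le)
  also have "card (set h - E) \<le> card (set h)"
    by (intro card_mono) auto
  also have "card (set h) \<le> length h"
    by (rule card_length)
  finally have "real (card (live {} (insertions rs E h))) \<le> real (card (live {} rs) + length h)"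
    by simp
  also have "\<dots> < c"
    using base Cons.prems by (simp add: base_def)
  finally show ?case
    using Cons \<open>live {} rs \<subseteq> E\<close> by (auto simp: insertions_Cons admissible_def
        admissible_from_append live_insertions)
qed

lemma insertions_snoc_admissible:
  assumes base: "base rs E T" and h: "set h \<subseteq> U" "length h < T" "k \<in> U" "k \<notin> E \<union> set h"
  shows "admissible U c (insertions rs E h @ [Allocate k])"
  using insertions_admissible [OF base, of "k # h"] h by (simp add: insertions_Cons)

text \<open>Since \<open>dereference\<close> does not see the state, for fixed \<open>w\<close> it
  is one function throughout the run, as the locale demands. Correctness after an allocation shows
  that the new slot was free before.\<close>

lemma process:
  assumes base: "base rs E T" and w: "w \<in> space M"
  shows "insertion_process U short_pointers n T (dereference D w n)
    (\<lambda>h. slots w (insertions rs E h)) (unserved rs E w)"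
proof
  show "finite U" "U \<noteq> {}" "finite short_pointers" "short_pointers \<noteq> {}" "0 < n"
    by (fact finite_U U_nonempty finite_short_pointers short_pointers_nonempty n_pos)+
next
  fix h assume "set h \<subseteq> U" "length h \<le> T"
  then show "slots w (insertions rs E h) \<subseteq> {..<n}"
    using base w by (intro slots_less insertions_admissible)
next
  fix h k assume h: "set h \<subseteq> U" "length h < T" "k \<in> U"
  let ?rs = "insertions rs E h"
  have fresh: "pointers D n q w ?rs k = None" if "k \<notin> E \<union> set h"
    using that base dom_pointers_subset_live [of D n q w ?rs]
    by (auto simp: live_insertions base_def)
  show "slots w (insertions rs E (k # h)) = slots w ?rs" if "unserved rs E w h k"
  proof (cases "k \<in> E \<union> set h")
    case False
    then have "pointers D n q w (?rs @ [Allocate k]) = pointers D n q w ?rs"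
      using that fresh pointers_Allocate [of D n q w ?rs k]
      by (simp add: unserved_def fun_upd_idem)
    then show ?thesis using False by (simp add: insertions_Cons)
  qed (simp add: insertions_Cons)
  show "\<exists>p\<in>short_pointers. dereference D w n k p \<notin> slots w ?rs \<and> dereference D w n k p < n \<and>
      slots w (insertions rs E (k # h)) = insert (dereference D w n k p) (slots w ?rs)"
    if served: "\<not> unserved rs E w h k"
  proof -
    have k: "k \<notin> E \<union> set h" using served by (auto simp: unserved_def)
    obtain p where p: "pointers D n q w (?rs @ [Allocate k]) k = Some p"
      using served by (auto simp: unserved_def)
    have adm: "admissible U c (?rs @ [Allocate k])"
      using base h k by (rule insertions_snoc_admissible)
    have upd: "pointers D n q w (?rs @ [Allocate k]) = (pointers D n q w ?rs)(k \<mapsto> p)"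
      using pointers_Allocate [of D n q w ?rs k] p by simp
    have "dereference D w n k p \<notin> slots w ?rs"
    proof
      assume "dereference D w n k p \<in> slots w ?rs"
      then obtain k' p' where k': "pointers D n q w ?rs k' = Some p'"
        "dereference D w n k p = dereference D w n k' p'"
        by (auto simp: occupied_def)
      then have "k' \<noteq> k" using fresh [OF k] by auto
      then have "pointers D n q w (?rs @ [Allocate k]) k' = Some p'"
        using k' upd by simp
      then show False
        using correct adm w p k' \<open>k' \<noteq> k\<close> unfolding correct_slots_def by metis
    qed
    moreover have "dereference D w n k p < n"
      using correct adm w p unfolding correct_slots_def by blast
    moreover have "slots w (?rs @ [Allocate k]) = insert (dereference D w n k p) (slots w ?rs)"
      unfolding upd by (rule occupied_update [of "pointers D n q w ?rs", OF fresh [OF k]])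
    moreover have "p \<in> short_pointers"
      using short [OF adm w p] by (simp add: short_pointers_def)
    ultimately show ?thesis
      using k by (auto simp: insertions_Cons)
  qed
qed

lemma unserved_measurable:
  assumes base: "base rs E T" and h: "set h \<subseteq> U" "length h < T" "k \<in> U"
  shows "{w \<in> space M. unserved rs E w h k} \<in> sets M"
    and "k \<notin> E \<union> set h \<Longrightarrow> measure M {w \<in> space M. unserved rs E w h k} \<le> \<epsilon>"
proof -
  have eq: "{w \<in> space M. unserved rs E w h k} = (if k \<in> E \<union> set h then space M
      else failure_event M D n q (insertions rs E h) k)"
    by (auto simp: unserved_def failure_event_def)
  show "{w \<in> space M. unserved rs E w h k} \<in> sets M"
    unfolding eq using failure insertions_snoc_admissible [OF base h]
    by (auto simp: failure_bounded_def)
  show "measure M {w \<in> space M. unserved rs E w h k} \<le> \<epsilon>" if "k \<notin> E \<union> set h"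
    unfolding eq using failure insertions_snoc_admissible [OF base h] that
    by (auto simp: failure_bounded_def)
qed

lemma integral_unserved:
  assumes base: "base rs E T" and h: "set h \<subseteq> U" "length h < T" "k \<in> U"
  shows "integrable M (\<lambda>w. of_bool (unserved rs E w h k) :: real)"
    and "(LINT w|M. of_bool (unserved rs E w h k)) \<le> (\<epsilon> + of_bool (k \<in> E \<union> set h) :: real)"
proof -
  let ?A = "{w \<in> space M. unserved rs E w h k}"
  have cong: "of_bool (unserved rs E w h k) = (indicator ?A w :: real)" if "w \<in> space M" for w
    using that by (simp add: indicator_def)
  show "integrable M (\<lambda>w. of_bool (unserved rs E w h k) :: real)"
    using unserved_measurable(1) [OF base h] 
    by (subst Bochner_Integration.integrable_cong [OF refl cong]) (auto simp: emeasure_eq_measure)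
  have "(LINT w|M. of_bool (unserved rs E w h k)) = measure M ?A"
    using unserved_measurable(1) [OF base h]
    by (subst Bochner_Integration.integral_cong [OF refl cong]) auto
  moreover have "measure M ?A \<le> \<epsilon> + of_bool (k \<in> E \<union> set h)"
  proof (cases "k \<in> E \<union> set h")
    case True
    then show ?thesis
      using order_trans [OF prob_le_1, of "\<epsilon> + 1" ?A] \<epsilon>_nonneg by simp
  qed (use unserved_measurable(2) [OF base h] in simp)
  ultimately show "(LINT w|M. of_bool (unserved rs E w h k)) \<le> (\<epsilon> + of_bool (k \<in> E \<union> set h) :: real)"
    by simp
qed

lemma integrable_failures:
  assumes base: "base rs E T" and "set h \<subseteq> U" "length h \<le> T"
  shows "integrable M (\<lambda>w. failures (unserved rs E w) h)"
  using assms(2-)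
proof (induction h)
  case (Cons k h)
  then show ?case
    using integral_unserved(1) [OF base, of h k] by (simp del: integrable_indicator_iff)
qed simp

text \<open>A fresh key fails with probability at most \<open>\<epsilon>\<close>. A uniform key lies
  among the excluded and earlier ones with probability at most
  \<open>(card E + T) / card U\<close>.\<close>

lemma avg_expected_failures:
  assumes base: "base rs E T"
  shows "avg_lists U T (\<lambda>h. LINT w|M. failures (unserved rs E w) h)
    \<le> real T * (\<epsilon> + real (card E + T) / real (card U))"
proof -
  define I where "I = (\<lambda>h. LINT w|M. failures (unserved rs E w) h)"
  define N where "N = real (card U)"
  have N: "0 < N" using finite_U U_nonempty by (simp add: N_def card_gt_0_iff)
  define e where "e = \<epsilon> + real (card E + T) / N"
  have "avg_lists U t I \<le> real t * e" if "t \<le> T" for t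
    using that
  proof (induction t)
    case 0
    show ?case by (simp add: I_def)
  next
    case (Suc t)
    have "avg_lists U (Suc t) I \<le> avg_lists U t (\<lambda>h. I h + e)"
      unfolding avg_lists.simps N_def [symmetric]
    proof (rule avg_lists_mono)
      fix h assume h: "set h \<subseteq> U" "length h = t"
      have "I (k # h) \<le> I h + (\<epsilon> + of_bool (k \<in> E \<union> set h))" if "k \<in> U" for k
      proof -
        have "I (k # h) = I h + (LINT w|M. of_bool (unserved rs E w h k))"
          unfolding I_def failures.simps using h Suc.prems that
          by (intro Bochner_Integration.integral_add integrable_failures [OF base]
              integral_unserved(1) [OF base]) auto
        then show ?thesis
          using integral_unserved(2) [OF base, of h k] h Suc.prems that by simp
      qed
      then have "(\<Sum>k\<in>U. I (k # h)) \<le> (\<Sum>k\<in>U. I h + (\<epsilon> + of_bool (k \<in> E \<union> set h)))"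
        by (rule sum_mono)
      also have "\<dots> = N * (I h + \<epsilon>) + (\<Sum>k\<in>U. of_bool (k \<in> E \<union> set h))"
        by (simp only: sum.distrib sum_constant N_def distrib_left add.assoc)
      also have "(\<Sum>k\<in>U. of_bool (k \<in> E \<union> set h)) = real (card (U \<inter> (E \<union> set h)))"
        by (simp only: sum_of_bool_eq [OF finite_U finite_U] Collect_mem_eq)
      also have "\<dots> \<le> real (card E + T)"
      proof -
        have "finite E" using base by (simp add: base_def)
        then have "card (U \<inter> (E \<union> set h)) \<le> card (E \<union> set h)"
          by (intro card_mono) auto
        also have "\<dots> \<le> card E + card (set h)" by (rule card_Un_le)
        finally show ?thesis
          using card_length [of h] h Suc.prems by simp
      qed
      finally have "(\<Sum>k\<in>U. I (k # h)) \<le> N * (I h + \<epsilon>) + real (card E + T)" by simp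
      moreover have "N * e = N * \<epsilon> + real (card E + T)"
        using N by (simp add: e_def distrib_left del: of_nat_add)
      ultimately have "(\<Sum>k\<in>U. I (k # h)) \<le> N * (I h + e)"
        by (simp add: distrib_left)
      then show "(\<Sum>k\<in>U. I (k # h)) / N \<le> I h + e"
        using N by (simp add: pos_divide_le_eq mult.commute)
    qed
    also have "\<dots> = avg_lists U t I + e"
      by (simp add: avg_lists_add avg_lists_const finite_U U_nonempty)
    finally show ?case using Suc by (simp add: algebra_simps)
  qed
  then show ?thesis by (simp add: I_def e_def N_def)
qed

text \<open>Lower bounds hold for each \<open>w\<close> on average over keys, upper bounds for each
  key list on average over \<open>w\<close>; exchanging the two averages makes them
  comparable.\<close>

lemma integral_avg_failures:
  assumes base: "base rs E T"
  shows "integrable M (\<lambda>w. avg_lists U T (failures (unserved rs E w)))"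
    and "(LINT w|M. avg_lists U T (failures (unserved rs E w)))
      \<le> real T * (\<epsilon> + real (card E + T) / real (card U))"
proof -
  have "integrable M (\<lambda>w. failures (unserved rs E w) h)" if "set h \<subseteq> U" "length h = T" for h
    using integrable_failures [OF base] that by simp
  from integral_avg_lists [of U T M "\<lambda>h w. failures (unserved rs E w) h", OF this]
    avg_expected_failures [OF base]
  show "integrable M (\<lambda>w. avg_lists U T (failures (unserved rs E w)))"
    and "(LINT w|M. avg_lists U T (failures (unserved rs E w)))
      \<le> real T * (\<epsilon> + real (card E + T) / real (card U))"
    by auto
qed

lemma iterated_bound:
  assumes T: "T = Suc (card short_pointers) * L" and "L \<le> n" and cap: "\<forall>t<T. real t < c"
  shows "real L / 4 * (real L / (8 * real n * real (card short_pointers))) ^ 2 ^ Suc (card short_pointers)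
    \<le> real T * (\<epsilon> + real T / real (card U))"
proof -
  have base: "base [] {} T"
    using cap by (simp add: base_def admissible_def)
  have "real L / 4 * (real L / (8 * real n * real (card short_pointers))) ^ 2 ^ Suc (card short_pointers)
      \<le> (LINT w|M. avg_lists U T (failures (unserved [] {} w)))"
    using insertion_process.avg_failures_lower_bound [OF process [OF base] T \<open>L \<le> n\<close>]
    by (intro integral_ge_const integral_avg_failures(1) [OF base] AE_I2)
  also have "\<dots> \<le> real T * (\<epsilon> + real (card ({} :: 'k set) + T) / real (card U))"
    by (rule integral_avg_failures(2) [OF base])
  finally show ?thesis by simp
qed

section \<open>Filling the table, freeing a block and refilling\<close>

text \<open>If the history has repetitions, the last blocks are shorter than \<open>T\<close> or empty.\<close>

definition block :: "nat \<Rightarrow> nat \<Rightarrow> 'k list \<Rightarrow> 'k list" where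
  "block T j h = take T (drop (j * T) (remdups h))"

definition churn :: "nat \<Rightarrow> nat \<Rightarrow> 'k list \<Rightarrow> 'k request list" where
  "churn T j h = insertions [] {} h @ map Free (block T j h)"

lemma set_block_subset: "set (block T j h) \<subseteq> set h"
  unfolding block_def by (metis set_drop_subset set_remdups set_take_subset subset_trans)

lemma disjoint_blocks:
  assumes "i \<noteq> j"
  shows "set (block T i h) \<inter> set (block T j h) = {}"
proof -
  have *: "set (block T i h) \<inter> set (block T j h) = {}" if "i < j" for i j :: nat
  proof -
    have "i * T + T \<le> j * T"
      using mult_right_mono [of "Suc i" j T] that by simp
    then have "block T j h = take T (drop (j * T - (i * T + T)) (drop T (drop (i * T) (remdups h))))"
      by (simp add: block_def add.commute)
    then have "set (block T j h) \<subseteq> set (drop T (drop (i * T) (remdups h)))"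
      by (metis set_drop_subset set_take_subset subset_trans)
    moreover have "set (block T i h) \<inter> set (drop T (drop (i * T) (remdups h))) = {}"
      unfolding block_def by (intro set_take_disj_set_drop_if_distinct) auto
    ultimately show ?thesis by blast
  qed
  show ?thesis
    using assms * [of i j] * [of j i] by (cases i j rule: linorder_cases) auto
qed

lemma base_fill:
  assumes "\<forall>t<m. real t < c"
  shows "base [] {} m"
  using assms by (simp add: base_def admissible_def)

text \<open>All of \<open>set h\<close> is excluded, so the freed keys are not requested again by
  the refill.\<close>

lemma base_churn:
  assumes cap: "\<forall>t<m. real t < c" and h: "set h \<subseteq> U" "length h = m"
    and j: "Suc j * T \<le> m"
  shows "base (churn T j h) (set h) T"
proof -
  have live: "live {} (churn T j h) = set h - set (block T j h)"
    by (simp add: churn_def live_append live_insertions live_Free)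
  have "admissible U c (churn T j h)"
    using insertions_admissible [OF base_fill [OF cap], of h] h set_block_subset [of T j h]
    by (auto simp: churn_def admissible_def admissible_from_append live_insertions block_def
        intro!: admissible_from_Free)
  \<comment> \<open>A full block frees \<open>T\<close> keys. A shorter or empty one extends to the
    end of the list of distinct keys, so at most \<open>j * T\<close> of them remain.\<close>
  moreover have "card (set h - set (block T j h)) + T \<le> m"
  proof -
    have "card (set h - set (block T j h)) = length (remdups h) - length (block T j h)"
      using set_block_subset [of T j h]
      by (subst card_Diff_subset) (auto simp: length_remdups_card_conv block_def distinct_card)
    moreover have "length (remdups h) \<le> m"
      using h length_remdups_leq by metis
    ultimately show ?thesis
      using j by (auto simp: block_def)
  qed
  ultimately show ?thesis
    using cap by (auto simp: base_def live simp del: of_nat_add)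
qed

text \<open>The last claim replaces the choice of a random block: as different blocks release
  disjoint sets of slots, the heavy slots released by all blocks together are at most all heavy
  slots.\<close>

lemma slots_churn:
  shows "slots w (churn T j h) \<subseteq> slots w (insertions [] {} h)"
    and "slots w (insertions [] {} h) - slots w (churn T j h) \<subseteq>
      (\<lambda>k. dereference D w n k (the (pointers D n q w (insertions [] {} h) k))) ` set (block T j h)"
    and "i \<noteq> j \<Longrightarrow> (slots w (insertions [] {} h) - slots w (churn T i h))
      \<inter> (slots w (insertions [] {} h) - slots w (churn T j h)) = {}"
proof -
  have *: "v \<in> slots w (churn T j h) \<longleftrightarrow> (\<exists>k p. v = dereference D w n k p \<and>
      pointers D n q w (insertions [] {} h) k = Some p \<and> k \<notin> set (block T j h))" for v j
    by (auto simp: churn_def pointers_Frees occupied_def restrict_map_def)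
  have **: "v \<in> slots w (insertions [] {} h) \<longleftrightarrow> (\<exists>k p. v = dereference D w n k p \<and>
      pointers D n q w (insertions [] {} h) k = Some p)" for v
    by (auto simp: occupied_def)
  show "slots w (churn T j h) \<subseteq> slots w (insertions [] {} h)"
    unfolding subset_iff * ** by blast
  show "slots w (insertions [] {} h) - slots w (churn T j h) \<subseteq>
      (\<lambda>k. dereference D w n k (the (pointers D n q w (insertions [] {} h) k))) ` set (block T j h)"
  proof
    fix v assume v: "v \<in> slots w (insertions [] {} h) - slots w (churn T j h)"
    then obtain k p where kp: "v = dereference D w n k p"
      "pointers D n q w (insertions [] {} h) k = Some p"
      using ** by blast
    with v have "k \<in> set (block T j h)" using * by blast
    then show "v \<in> (\<lambda>k. dereference D w n k (the (pointers D n q w (insertions [] {} h) k))) ` set (block T j h)"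
      using kp by (intro image_eqI [of _ _ k]) simp_all
  qed
  show "(slots w (insertions [] {} h) - slots w (churn T i h))
      \<inter> (slots w (insertions [] {} h) - slots w (churn T j h)) = {}" if "i \<noteq> j"
    using disjoint_blocks [OF that, of T h] * ** by blast
qed

text \<open>\<open>heavy_exhaustion\<close> is applied to the refill after each block and summed
  over the blocks. A heavy slot free before the refill was either empty after the filling or
  released by the block.\<close>

lemma churn_failures:
  assumes cap: "\<forall>t<m. real t < c" and h: "set h \<subseteq> U" "length h = m"
    and J: "J * T \<le> m" and "m \<le> n" and w: "w \<in> space M" and r: "0 < r"
  shows "real J * real T * (1 - (real n - real m + failures (unserved [] {} w) h + real T) / (2 * r))
    \<le> real J * (real n - real m + failures (unserved [] {} w) h) + 2 * r * real (card short_pointers)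
      + (\<Sum>j<J. avg_lists U T (failures (unserved (churn T j h) (set h) w)))"
proof -
  let ?S = "slots w (insertions [] {} h)" and ?S' = "\<lambda>j. slots w (churn T j h)"
  \<comment> \<open>The number of empty slots after the filling; each failure leaves one
    more.\<close>
  define x where "x = real n - real m + failures (unserved [] {} w) h"
  interpret fill: insertion_process U short_pointers n m "dereference D w n"
    "\<lambda>h. slots w (insertions [] {} h)" "unserved [] {} w"
    by (rule process [OF base_fill [OF cap] w])
  let ?H = "fill.heavy_slots r"
  have finH: "finite ?H" "?H \<subseteq> {..<n}" by (auto simp: fill.heavy_slots_def)
  have S: "?S \<subseteq> {..<n}"
    using h by (intro slots_less [OF insertions_admissible [OF base_fill [OF cap]] w]) auto
  have finS: "finite ?S" using S by (rule finite_subset) simp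
  have "slots w (insertions [] {} []) = {}"
    by (simp add: insertions_Nil pointers_def execute_def occupied_def)
  then have cardS: "real (card ?S) = real n - x"
    using fill.card_Occ [of h] h by (simp add: x_def)
  have each: "real T * (1 - (x + real T) / (2 * r)) \<le> x + real (card (?H \<inter> (?S - ?S' j)))
      + avg_lists U T (failures (unserved (churn T j h) (set h) w))" if "j < J" for j
  proof -
    have "Suc j * T \<le> m"
      using mult_right_mono [of "Suc j" J T] J that by simp
    note base = base_churn [OF cap h this]
    \<comment> \<open>\<open>heavy_slots\<close> depends only on the universe, the pointers,
      \<open>n\<close> and \<open>dereference\<close>, so the filling and all refills share the set
      \<open>?H\<close>.\<close>
    interpret insertion_process U short_pointers n T "dereference D w n"
      "\<lambda>h'. slots w (insertions (churn T j h) (set h) h')" "unserved (churn T j h) (set h) w"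
      by (rule process [OF base w])
    have S': "?S' j \<subseteq> ?S" by (rule slots_churn)
    have "card (?S - ?S' j) \<le> card ((\<lambda>k. dereference D w n k
        (the (pointers D n q w (insertions [] {} h) k))) ` set (block T j h))"
      by (intro card_mono slots_churn) simp
    also have "\<dots> \<le> card (set (block T j h))" by (rule card_image_le) simp
    also have "\<dots> \<le> T" using card_length [of "block T j h"] by (simp add: block_def)
    finally have "card ?S \<le> card (?S' j) + T"
      using S' finS by (simp add: card_Diff_subset finite_subset)
    moreover have "card (?S' j) \<le> n"
      using card_mono [of "{..<n}" "?S' j"] S S' by auto
    ultimately have free: "real (n - card (?S' j)) \<le> x + real T"
      using cardS by simp
    have "?H - ?S' j \<subseteq> ({..<n} - ?S) \<union> (?H \<inter> (?S - ?S' j))"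
      using finH by auto
    then have "card (?H - ?S' j) \<le> card (({..<n} - ?S) \<union> (?H \<inter> (?S - ?S' j)))"
      using finH by (intro card_mono) auto
    also have "\<dots> \<le> card ({..<n} - ?S) + card (?H \<inter> (?S - ?S' j))"
      by (rule card_Un_le)
    also have "card ({..<n} - ?S) = n - card ?S"
      using S finS by (simp add: card_Diff_subset)
    finally have heavy: "real (card (?H - ?S' j)) \<le> x + real (card (?H \<inter> (?S - ?S' j)))"
      using cardS card_mono [OF _ S] by simp
    have "real T * (1 - (x + real T) / (2 * r)) \<le> real T * (1 - real (n - card (?S' j)) / (2 * r))"
      using free r by (intro mult_left_mono diff_left_mono divide_right_mono) auto
    also have "\<dots> \<le> real (card (?H - ?S' j)) + avg_lists U T (failures (unserved (churn T j h) (set h) w))"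
      using heavy_exhaustion [OF r] by (simp add: insertions_Nil)
    finally show ?thesis using heavy by simp
  qed
  have "(\<Sum>j<J. card (?H \<inter> (?S - ?S' j))) = card (\<Union>j<J. ?H \<inter> (?S - ?S' j))"
    using finH slots_churn(3) [of _ _ w h T] by (intro card_UN_disjoint [symmetric]) blast+
  also have "\<dots> \<le> card ?H"
    using finH by (intro card_mono) auto
  finally have "(\<Sum>j<J. real (card (?H \<inter> (?S - ?S' j)))) \<le> real (card ?H)"
    by (simp flip: of_nat_sum)
  also have "\<dots> \<le> 2 * r * real (card short_pointers)"
    by (rule fill.card_heavy_slots [OF r])
  finally have heavy: "(\<Sum>j<J. real (card (?H \<inter> (?S - ?S' j)))) \<le> 2 * r * real (card short_pointers)" .
  have "real J * (real T * (1 - (x + real T) / (2 * r))) = (\<Sum>j<J. real T * (1 - (x + real T) / (2 * r)))"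
    by simp
  also have "\<dots> \<le> (\<Sum>j<J. x + real (card (?H \<inter> (?S - ?S' j)))
      + avg_lists U T (failures (unserved (churn T j h) (set h) w)))"
    by (intro sum_mono each) simp
  also have "\<dots> = real J * x + (\<Sum>j<J. real (card (?H \<inter> (?S - ?S' j))))
      + (\<Sum>j<J. avg_lists U T (failures (unserved (churn T j h) (set h) w)))"
    by (simp only: sum.distrib sum_constant card_lessThan)
  finally show ?thesis
    using heavy by (simp only: x_def mult.assoc) 
qed

text \<open>The previous inequality is affine in the failure counts, so they may be replaced by
  their expectations. The rate \<open>e\<close> covers failures and repetitions among up to
  \<open>2 * n\<close> keys.\<close>

lemma churn_bound:
  assumes cap: "\<forall>t<m. real t < c" and J: "J * T \<le> m" and "m \<le> n" "T \<le> n" and r: "0 < r"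
    and e: "\<epsilon> + 2 * real n / real (card U) \<le> e"
  shows "real J * real T * (1 - (real n - real m + real n * e + real T) / (2 * r))
    \<le> real J * (real n - real m + real n * e) + 2 * r * real (card short_pointers) + real J * real T * e"
proof -
  define I where "I = (\<lambda>h. LINT w|M. failures (unserved [] {} w) h)"
  define a where "a = real J * real T / (2 * r)"
  \<comment> \<open>The part of the inequality without failures; \<open>a + J\<close> is the weight
    of the failures during the filling.\<close>
  define K where "K = real J * real T - a * (real n - real m + real T)
    - real J * (real n - real m) - 2 * r * real (card short_pointers)"
  have a: "0 \<le> a + real J" using r by (simp add: a_def)
  have expand: "real J * real T * (1 - y / (2 * r)) = real J * real T - a * y" for y
    by (simp add: a_def algebra_simps)
  have e_bound: "\<epsilon> + real (i + t) / real (card U) \<le> e" if "i \<le> n" "t \<le> n" for i t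
  proof -
    have "real (i + t) / real (card U) \<le> 2 * real n / real (card U)"
      using that by (intro divide_right_mono) auto
    with e show ?thesis by simp
  qed
  have "0 \<le> e" using e \<epsilon>_nonneg by (auto intro: order_trans [rotated])
  have "K \<le> (a + real J) * I h + real J * real T * e" if h: "set h \<subseteq> U" "length h = m" for h
  proof -
    have base: "base (churn T j h) (set h) T" if "j < J" for j
      using mult_right_mono [of "Suc j" J T] J that by (intro base_churn [OF cap h]) simp
    have int1: "integrable M (\<lambda>w. failures (unserved [] {} w) h)"
      using h by (intro integrable_failures [OF base_fill [OF cap]]) auto
    have int2: "integrable M (\<lambda>w. avg_lists U T (failures (unserved (churn T j h) (set h) w)))"
      if "j < J" for j
      by (rule integral_avg_failures(1) [OF base [OF that]])
    have "K \<le> (LINT w|M. (a + real J) * failures (unserved [] {} w) h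
        + (\<Sum>j<J. avg_lists U T (failures (unserved (churn T j h) (set h) w))))"
    proof (intro integral_ge_const AE_I2)
      fix w assume "w \<in> space M"
      from churn_failures [OF cap h J \<open>m \<le> n\<close> this r]
      show "K \<le> (a + real J) * failures (unserved [] {} w) h
          + (\<Sum>j<J. avg_lists U T (failures (unserved (churn T j h) (set h) w)))"
        unfolding expand by (simp add: K_def algebra_simps)
    qed (intro Bochner_Integration.integrable_add Bochner_Integration.integrable_sum
        integrable_mult_right int1 int2, simp)
    also have "\<dots> = (a + real J) * I h
        + (\<Sum>j<J. LINT w|M. avg_lists U T (failures (unserved (churn T j h) (set h) w)))"
      using int2
      by (subst Bochner_Integration.integral_add)
        (auto simp: I_def Bochner_Integration.integral_sum simp del: distrib_right
          intro!: Bochner_Integration.integrable_sum integrable_mult_right int1)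
    also have "(\<Sum>j<J. LINT w|M. avg_lists U T (failures (unserved (churn T j h) (set h) w)))
        \<le> (\<Sum>j<J. real T * e)"
    proof (rule sum_mono)
      fix j assume "j \<in> {..<J}"
      then have "(LINT w|M. avg_lists U T (failures (unserved (churn T j h) (set h) w)))
          \<le> real T * (\<epsilon> + real (card (set h) + T) / real (card U))"
        by (intro integral_avg_failures(2) base) simp
      also have "\<dots> \<le> real T * e"
        using card_length [of h] h \<open>m \<le> n\<close> \<open>T \<le> n\<close> by (intro mult_left_mono e_bound) auto
      finally show "(LINT w|M. avg_lists U T (failures (unserved (churn T j h) (set h) w))) \<le> real T * e" .
    qed
    finally show ?thesis by simp
  qed
  then have "avg_lists U m (\<lambda>_. K) \<le> avg_lists U m (\<lambda>h. (a + real J) * I h + real J * real T * e)"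
    by (rule avg_lists_mono)
  then have "K \<le> (a + real J) * avg_lists U m I + real J * real T * e"
    by (simp add: avg_lists_const avg_lists_add avg_lists_cmult finite_U U_nonempty)
  also have "avg_lists U m I \<le> real m * (\<epsilon> + real (card ({} :: 'k set) + m) / real (card U))"
    unfolding I_def by (rule avg_expected_failures [OF base_fill [OF cap]])
  also have "\<dots> \<le> real n * e"
    using \<open>m \<le> n\<close> e_bound [of 0 m] \<open>0 \<le> e\<close> \<epsilon>_nonneg by (intro mult_mono) auto
  finally have "K \<le> (a + real J) * (real n * e) + real J * real T * e"
    using a by (simp add: mult_left_mono)
  then show ?thesis
    unfolding expand by (simp add: K_def algebra_simps)
qed

section \<open>Numerical consequences for the pointer size\<close>

lemma card_short_pointers_pos: "0 < card short_pointers"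
  using finite_short_pointers short_pointers_nonempty by (simp add: card_gt_0_iff)

text \<open>With fewer than \<open>z\<close> pointers, \<open>\<rho>\<close> is below the base of
  the power in \<open>iterated_bound\<close>, while \<open>2 powr (z + 1)\<close> is above its
  exponent. After cancelling \<open>L\<close>, that bound contradicts \<open>less\<close>.\<close>

lemma card_short_pointers_ge:
  fixes z c0 :: real and m :: nat
  defines "\<rho> \<equiv> c0 / (16 * (z + 1) * z)"
  assumes z: "1 \<le> z" and c0: "0 < c0" "c0 \<le> 1" and n_large: "4 * (z + 1) < c0 * real n"
    and m: "c0 * real n \<le> real m" "m \<le> n" and cap: "\<forall>t<m. real t < c"
    and U_large: "n ^ 2 \<le> card U"
    and less: "(z + 1) * (\<epsilon> + 1 / real n) < 1 / 4 * \<rho> powr (2 powr (z + 1))"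
  shows "z \<le> real (card short_pointers)"
proof (rule ccontr)
  define d where "d = card short_pointers"
  assume "\<not> z \<le> real (card short_pointers)"
  then have d: "real d < z" by (simp add: d_def)
  have d_pos: "1 \<le> real d" using card_short_pointers_pos by (simp add: d_def)
  define L where "L = m div Suc d"
  define T where "T = Suc d * L"
  have "T \<le> m" unfolding T_def L_def by (rule times_div_less_eq_dividend)
  have n: "0 < real n" using n_pos by simp
  have "m < Suc d * Suc L"
    unfolding L_def using dividend_less_times_div [of "Suc d" m] by simp
  then have "real m < (real d + 1) * (real L + 1)"
    by (metis of_nat_Suc of_nat_less_iff of_nat_mult add.commute)
  also have "\<dots> \<le> (z + 1) * (real L + 1)"
    using d by (intro mult_right_mono) auto
  finally have "c0 * real n < (z + 1) * real L + (z + 1)"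
    using m by (simp add: algebra_simps)
  \<comment> \<open>The assumption \<open>n_large\<close> absorbs the rounding in
    \<open>m div Suc d\<close>.\<close>
  then have Lz: "c0 * real n < 2 * ((z + 1) * real L)"
    using n_large z by argo
  have L_pos: "0 < real L"
    using Lz mult_pos_pos [OF c0(1) n] by (cases L) auto
  have "\<rho> \<le> real L / (8 * real n * real d)"
  proof -
    have "c0 * (8 * real n * real d) \<le> c0 * (8 * real n * z)"
      using d c0 n by (intro mult_left_mono) auto
    also have "\<dots> = 8 * z * (c0 * real n)" by simp
    also have "\<dots> \<le> 8 * z * (2 * ((z + 1) * real L))"
      using Lz z by (intro mult_left_mono) auto
    finally show ?thesis
      using z n d_pos by (simp add: \<rho>_def frac_le_eq divide_le_eq le_divide_eq mult_ac)
  qed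
  then have "\<rho> ^ 2 ^ Suc d \<le> (real L / (8 * real n * real d)) ^ 2 ^ Suc d"
    using z c0 by (intro power_mono) (auto simp: \<rho>_def)
  moreover have "\<rho> powr (2 powr (z + 1)) \<le> \<rho> ^ 2 ^ Suc d"
  proof -
    have \<rho>: "0 < \<rho>" "\<rho> \<le> 1"
    proof -
      have "1 * 1 \<le> (z + 1) * z" using z by (intro mult_mono) auto
      then have "c0 \<le> 16 * ((z + 1) * z)" using c0 by argo
      then show "0 < \<rho>" "\<rho> \<le> 1" using z c0 by (simp_all add: \<rho>_def algebra_simps)
    qed
    have "real (2 ^ Suc d) = 2 powr (real d + 1)"
      by (simp add: powr_add powr_realpow)
    also have "\<dots> \<le> 2 powr (z + 1)" using d by simp
    finally have "\<rho> powr (2 powr (z + 1)) \<le> \<rho> powr real (2 ^ Suc d)"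
      using \<rho> by (intro powr_mono') auto
    also have "\<dots> = \<rho> ^ 2 ^ Suc d" by (rule powr_realpow) (fact \<rho>)
    finally show ?thesis .
  qed
  ultimately have "real L * (1 / 4 * \<rho> powr (2 powr (z + 1)))
      \<le> real L / 4 * (real L / (8 * real n * real d)) ^ 2 ^ Suc d"
    by (simp add: mult_left_mono)
  also have "\<dots> \<le> real T * (\<epsilon> + real T / real (card U))"
  proof -
    have "L \<le> n" using m by (auto simp: L_def intro: order_trans [OF div_le_dividend])
    moreover have "\<forall>t<T. real t < c" using cap \<open>T \<le> m\<close> by auto
    ultimately show ?thesis
      using iterated_bound [of T L] by (simp add: T_def d_def)
  qed
  \<comment> \<open>A quadratic universe makes repetitions cost at most \<open>1 / n\<close> per
    request.\<close>
  also have "\<dots> \<le> real T * (\<epsilon> + 1 / real n)"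
  proof -
    have "real T / real (card U) \<le> real n / real (n ^ 2)"
      using U_large \<open>T \<le> m\<close> m n_pos by (intro frac_le) (simp_all flip: of_nat_power)
    also have "\<dots> = 1 / real n" by (simp add: power2_eq_square)
    finally show ?thesis by (intro mult_left_mono) auto
  qed
  also have "real T = real L * (real d + 1)"
    by (simp add: T_def algebra_simps)
  also have "\<dots> * (\<epsilon> + 1 / real n) = real L * ((real d + 1) * (\<epsilon> + 1 / real n))"
    by (rule mult.assoc)
  also have "\<dots> \<le> real L * ((z + 1) * (\<epsilon> + 1 / real n))"
    using d \<epsilon>_nonneg n by (intro mult_left_mono mult_right_mono) auto
  also have "\<dots> < real L * (1 / 4 * \<rho> powr (2 powr (z + 1)))"
    using less L_pos by (rule mult_strict_left_mono)
  finally show False by simp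
qed

lemma size_ge_of_deficit:
  fixes e :: real and m u :: nat
  assumes m: "m \<le> n" "c0 * real n \<le> real m" and cap: "\<forall>t<m. real t < c"
    and e: "\<epsilon> + 2 * real n / real (card U) \<le> e" "e \<le> 1 / 16"
    and u: "1 \<le> u" "real n - real m \<le> real u" "real n * e \<le> real u"
  shows "c0 * real n \<le> 240 * 2 ^ s * real u"
proof -
  define d where "d = real (card short_pointers)"
  \<comment> \<open>With \<open>r = 10 * u\<close> and at most \<open>2 * u + T = r\<close> free
    slots, light slots serve at most half of the new keys. Of the remaining \<open>4 * u\<close> per
    block, \<open>2 * u\<close> find empty slots and \<open>u / 2\<close> fail, so
    \<open>3 * u / 2\<close> need released heavy slots, of which there are at most
    \<open>20 * u * d\<close> over all blocks.\<close>
  define T where "T = 8 * u"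
  define J where "J = m div T"
  have J3: "3 * real J \<le> 40 * d"
  proof (cases "J = 0")
    case False
    have JT: "J * T \<le> m" by (simp add: J_def div_times_less_eq_dividend)
    have "T \<le> J * T" using False by (cases J) auto
    also note JT
    also note m(1)
    finally have "T \<le> n" .
    have u0: "0 < real u" using u by simp
    have "real J * real T * (1 / 2) \<le> real J * real T *
        (1 - (real n - real m + real n * e + real T) / (2 * (10 * real u)))"
      using u u0 by (intro mult_left_mono) (auto simp: T_def field_simps)
    also have "\<dots> \<le> real J * (real n - real m + real n * e) + 2 * (10 * real u) * d + real J * real T * e"
      unfolding d_def using u0 by (intro churn_bound cap JT m \<open>T \<le> n\<close> e) simp
    also have "\<dots> \<le> real J * (2 * real u) + 2 * (10 * real u) * d + real J * real T * (1 / 16)"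
      using u e by (intro add_mono mult_left_mono) auto
    finally have "real u * (3 * real J) \<le> real u * (40 * d)"
      by (simp add: T_def algebra_simps)
    then show ?thesis using u0 by simp
  qed (simp add: d_def)
  have "d \<le> real (2 ^ Suc s)"
    using card_short_pointers by (simp add: d_def del: power_Suc)
  then have d: "d \<le> 2 * 2 ^ s" by simp
  have "m < T * Suc J"
    unfolding J_def using u dividend_less_times_div [of T m] by (simp add: T_def)
  then have "real m \<le> real T * (real J + 1)"
    by (metis of_nat_Suc of_nat_mult of_nat_less_iff less_imp_le add.commute)
  also have "\<dots> = real u * (8 * (real J + 1))" by (simp add: T_def)
  also have "\<dots> \<le> real u * (240 * 2 ^ s)"
  proof (rule mult_left_mono)
    have "(1::real) \<le> 2 ^ s" by simp
    with J3 d show "8 * (real J + 1) \<le> 240 * 2 ^ s" by argo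
  qed simp
  finally show ?thesis using m by (simp add: mult_ac)
qed

end

subsection \<open>Asymptotics\<close>

text \<open>For \<open>z = ln (ln n) / 4\<close> the exponent \<open>2 powr (z + 1)\<close> is at
  most \<open>exp (z + 1)\<close>, of order \<open>(ln n) powr (1 / 4)\<close>, and the base is the
  inverse of a polynomial \<open>R\<close> in \<open>z\<close>. So the right side decays more slowly
  than every negative power of \<open>n\<close>; the estimate \<open>ln R \<le> R\<close> is
  enough.\<close>

lemma iterated_loss_negligible:
  fixes c0 K a :: real
  assumes "0 < c0" "0 < K" "0 < a" "a \<le> 1"
  shows "\<forall>\<^sub>F n in sequentially.
    (ln (ln (real n)) / 4 + 1) * (K * real n powr - a + 1 / real n)
      < 1 / 4 * (c0 / (16 * (ln (ln (real n)) / 4 + 1) * (ln (ln (real n)) / 4)))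
          powr (2 powr (ln (ln (real n)) / 4 + 1))"
proof -
  have "\<forall>\<^sub>F n in sequentially.
      (ln (ln (real n)) / 4 + 1) * (K * real n powr - a + real n powr - a) < real n powr (- a / 2)"
    using assms by real_asymp
  moreover have "\<forall>\<^sub>F n in sequentially.
      exp (ln (ln (real n)) / 4 + 1)
        * (16 * (ln (ln (real n)) / 4 + 1) * (ln (ln (real n)) / 4) / c0) + ln 4
      < a / 2 * ln (real n)"
    using assms by real_asymp
  moreover have "\<forall>\<^sub>F n in sequentially. 4 < ln (ln (real n))"
    by real_asymp
  ultimately show ?thesis
    using eventually_gt_at_top [of 0]
  proof eventually_elim
    case (elim n)
    define z where "z = ln (ln (real n)) / 4"
    define R where "R = 16 * (z + 1) * z / c0"
    have z: "1 < z" using elim by (simp add: z_def)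
    have R: "0 < R" using z assms by (simp add: R_def)
    have n: "1 \<le> real n" using elim by simp
    have "real n powr -1 \<le> real n powr - a"
      using n assms by (intro powr_mono) auto
    then have "1 / real n \<le> real n powr - a"
      using n by (simp add: powr_minus_divide)
    then have "(z + 1) * (K * real n powr - a + 1 / real n)
        \<le> (z + 1) * (K * real n powr - a + real n powr - a)"
      using z by (intro mult_left_mono) auto
    also have "\<dots> < real n powr (- a / 2)"
      using elim by (simp add: z_def)
    also have "\<dots> = exp (- (a / 2 * ln (real n)))"
      using n by (simp add: powr_def)
    also have "\<dots> \<le> exp (- (2 powr (z + 1) * ln R + ln 4))"
    proof -
      have "(2::real) powr (z + 1) \<le> exp (z + 1)"
      proof -
        have "(z + 1) * ln 2 \<le> (z + 1) * 1"
          using z ln_le_minus_one [of "2::real"] by (intro mult_left_mono) auto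
        then show ?thesis by (simp add: powr_def)
      qed
      moreover have "ln R \<le> R" using ln_le_minus_one [OF R] by simp
      ultimately have "2 powr (z + 1) * ln R \<le> exp (z + 1) * R"
        using R by (meson mult_left_mono mult_right_mono order_trans powr_ge_zero less_imp_le)
      moreover have "exp (z + 1) * R + ln 4 < a / 2 * ln (real n)"
        unfolding z_def R_def by (rule elim)
      ultimately show ?thesis
        unfolding exp_le_cancel_iff by linarith
    qed
    also have "\<dots> = 1 / 4 * (1 / R) powr (2 powr (z + 1))"
      using R by (simp add: powr_def ln_div exp_diff exp_minus exp_add field_simps)
    also have "1 / R = c0 / (16 * (z + 1) * z)"
      by (simp add: R_def)
    finally show ?case by (simp add: z_def)
  qed
qed

text \<open>\<open>\<mu>\<close> is a deficit blurred by a polynomially small error. If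
  \<open>\<delta>\<close> dominates the error, only a constant is lost. Otherwise
  \<open>ln (1 / \<mu>)\<close> is at least \<open>a * ln x\<close> up to a constant, which by
  \<open>poly\<close> is still a fraction \<open>a / b\<close> of \<open>ln (1 / \<delta>)\<close>,
  again up to a constant.\<close>

lemma ln_inverse_le_ln_ratio:
  fixes a b K K' \<delta> \<mu> x :: real
  assumes a: "0 < a" "a \<le> b" and K: "1 \<le> K" "1 \<le> K'" and x: "1 \<le> x" and \<delta>: "0 < \<delta>" "\<delta> < 1"
    and poly: "1 / \<delta> \<le> K * x powr b" and \<mu>: "0 < \<mu>" "\<mu> \<le> \<delta> + K' * x powr - a"
  shows "a / b * ln (1 / \<delta>) - ln K - ln (K' + 1) \<le> ln (1 / \<mu>)"
proof -
  have ln_pos: "0 \<le> ln (1 / \<delta>)" "0 \<le> ln K" using \<delta> K by auto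
  have ab: "0 \<le> a / b" "a / b \<le> 1" using a by auto
  show ?thesis
  proof (cases "x powr - a \<le> \<delta>")
    case True
    then have "K' * x powr - a \<le> K' * \<delta>" using K by (intro mult_left_mono) auto
    then have "\<mu> \<le> (K' + 1) * \<delta>"
      using \<mu> by (simp add: algebra_simps)
    then have "ln \<mu> \<le> ln ((K' + 1) * \<delta>)" using \<mu> by (intro ln_mono) auto
    moreover have "a / b * ln (1 / \<delta>) \<le> 1 * ln (1 / \<delta>)"
      using ab ln_pos by (intro mult_right_mono)
    moreover have "ln ((K' + 1) * \<delta>) = ln (K' + 1) - ln (1 / \<delta>)" "ln (1 / \<mu>) = - ln \<mu>"
      using \<delta> \<mu> K by (simp_all add: ln_mult ln_div)
    ultimately show ?thesis
      using ln_pos by linarith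
  next
    case False
    then have "\<mu> \<le> (K' + 1) * x powr - a"
      using \<mu> by (simp add: algebra_simps)
    then have "ln \<mu> \<le> ln ((K' + 1) * x powr - a)" using \<mu> by (intro ln_mono) auto
    also have "\<dots> = ln (K' + 1) - a * ln x"
      using K x by (simp add: ln_mult ln_powr)
    finally have 1: "ln \<mu> \<le> ln (K' + 1) - a * ln x" .
    have "ln (1 / \<delta>) \<le> ln (K * x powr b)" using poly \<delta> by (intro ln_mono) auto
    also have "\<dots> = ln K + b * ln x" using K x by (simp add: ln_mult ln_powr)
    finally have "a / b * ln (1 / \<delta>) \<le> a / b * (ln K + b * ln x)"
      using ab by (intro mult_left_mono)
    also have "\<dots> = a / b * ln K + a * ln x"
      using a by (simp add: field_simps)
    also have "\<dots> \<le> ln K + a * ln x"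
      using mult_right_mono [OF ab(2) ln_pos(2)] by simp
    finally show ?thesis using 1 \<mu> by (simp add: ln_div)
  qed
qed


theorem theorem4:
  shows "\<exists>C::nat. \<forall>(M :: 'w measure) (D :: ('w, 'k, 's) deref_table) (q :: nat \<Rightarrow> nat)
      (U :: nat \<Rightarrow> 'k set) (\<delta> :: nat \<Rightarrow> real) (\<epsilon> :: nat \<Rightarrow> real) (s :: nat \<Rightarrow> nat).
    prob_space M \<longrightarrow>
    (\<forall>\<^sub>F n in sequentially. finite (U n) \<and> card (U n) \<ge> n ^ C) \<longrightarrow>
    (\<forall>\<^sub>F n in sequentially. 0 < \<delta> n \<and> \<delta> n < 1) \<longrightarrow>
    (\<lambda>n. 1 - \<delta> n) \<in> \<Omega>(\<lambda>_. 1) \<longrightarrow>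
    poly_bounded (\<lambda>n. 1 / \<delta> n) \<longrightarrow>
    inverse_poly \<epsilon> \<longrightarrow>
    (\<forall>\<^sub>F n in sequentially. supports_load_factor M D n (q n) (U n) (1 - \<delta> n) (\<epsilon> n)) \<longrightarrow>
    (\<forall>\<^sub>F n in sequentially. fixed_size_pointers M D n (q n) (U n) (1 - \<delta> n) (s n)) \<longrightarrow>
    (\<lambda>n. real (s n)) \<in> \<Omega>(\<lambda>n. ln (ln (ln (real n))) + ln (1 / \<delta> n))"
\<comment> \<open>Among \<open>n ^ 2\<close> keys, a random one repeats one of \<open>O(n)\<close>
  earlier keys with probability \<open>O(1 / n)\<close>, which is inverse polynomial like
  \<open>\<epsilon>\<close>.\<close>
proof (rule exI [of _ 2], intro allI impI)
  fix M :: "'w measure" and D :: "('w, 'k, 's) deref_table" and q U and \<delta> \<epsilon> :: "nat \<Rightarrow> real"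
    and s :: "nat \<Rightarrow> nat"
  assume M: "prob_space M"
    and U: "\<forall>\<^sub>F n in sequentially. finite (U n) \<and> card (U n) \<ge> n ^ 2"
    and \<delta>: "\<forall>\<^sub>F n in sequentially. 0 < \<delta> n \<and> \<delta> n < 1"
    and load: "(\<lambda>n. 1 - \<delta> n) \<in> \<Omega>(\<lambda>_. 1)"
    and poly: "poly_bounded (\<lambda>n. 1 / \<delta> n)" and inv_poly: "inverse_poly \<epsilon>"
    and supports: "\<forall>\<^sub>F n in sequentially. supports_load_factor M D n (q n) (U n) (1 - \<delta> n) (\<epsilon> n)"
    and fixed: "\<forall>\<^sub>F n in sequentially. fixed_size_pointers M D n (q n) (U n) (1 - \<delta> n) (s n)"
  obtain c' where c': "0 < c'" "\<forall>\<^sub>F n in sequentially. c' \<le> \<bar>1 - \<delta> n\<bar>"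
    using landau_omega.bigE [OF load] by auto
  define c0 where "c0 = min c' 1"
  have c0: "0 < c0" "c0 \<le> 1" using c' by (auto simp: c0_def)
  obtain a' where a': "0 < a'" "\<epsilon> \<in> O(\<lambda>n. real n powr - a')"
    using inv_poly by (auto simp: inverse_poly_def)
  obtain K1 where K1: "0 < K1" "\<forall>\<^sub>F n in sequentially. \<bar>\<epsilon> n\<bar> \<le> K1 * (real n powr - a')"
    using landau_o.bigE [OF a'(2)] by auto
  \<comment> \<open>The cap at 1 lets \<open>n powr - a\<close> dominate the repetition term
    \<open>1 / n\<close> too.\<close>
  define a where "a = min a' 1"
  have a: "0 < a" "a \<le> 1" "a \<le> a'" using a' by (auto simp: a_def)
  obtain b' where b': "(\<lambda>n. 1 / \<delta> n) \<in> O(\<lambda>n. real n powr b')"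
    using poly by (auto simp: poly_bounded_def)
  obtain K2 where K2: "0 < K2" "\<forall>\<^sub>F n in sequentially. \<bar>1 / \<delta> n\<bar> \<le> K2 * (real n powr b')"
    using landau_o.bigE [OF b'] by auto
  define b where "b = max b' 1"
  have b: "a \<le> b" "b' \<le> b" using a by (auto simp: b_def)
  define K3 where "K3 = max K2 1"
  have K3: "1 \<le> K3" "K2 \<le> K3" by (auto simp: K3_def)
  \<comment> \<open>Constants lost in the deficit bound: \<open>240 / c0\<close> from
    \<open>size_ge_of_deficit\<close>, the other two from \<open>ln_inverse_le_ln_ratio\<close> with
    \<open>K' = K1 + 4\<close>.\<close>
  define G where "G = ln (240 / c0) + ln K3 + ln (K1 + 5)"
  have "\<forall>\<^sub>F n in sequentially. (K1 + 2) * real n powr - a \<le> 1 / 16"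
    using a by real_asymp
  moreover have "\<forall>\<^sub>F n in sequentially. 4 * (ln (ln (real n)) / 4 + 1) < c0 * real n"
    using c0 by real_asymp
  moreover have "\<forall>\<^sub>F n in sequentially. 4 < ln (ln (real n))"
    by real_asymp
  moreover have "\<forall>\<^sub>F n in sequentially. 2 * (3 + G) < ln (ln (ln (real n)))"
    by real_asymp
  \<comment> \<open>Adding the two lower bounds on \<open>s n\<close> costs a factor 2; absorbing
    \<open>3 + G\<close> into half of the triple logarithm costs another. The second conjunct
    removes the absolute value in \<Omega>.\<close>
  ultimately have "\<forall>\<^sub>F n in sequentially.
      a / (4 * b) * (ln (ln (ln (real n))) + ln (1 / \<delta> n)) \<le> real (s n) \<and>
      0 \<le> ln (ln (ln (real n))) + ln (1 / \<delta> n)"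
    using iterated_loss_negligible [OF c0(1) K1(1) a(1,2)] c'(2) K1(2) K2(2) U \<delta> supports fixed
      eventually_gt_at_top [of 0]
  proof eventually_elim
    case (elim n)
    have n: "0 < n" "1 \<le> real n" and \<delta>n: "0 < \<delta> n" "\<delta> n < 1"
      using elim by auto
    \<comment> \<open>A nonnegative bound on the failure probability, as the locale
      requires.\<close>
    define E where "E = K1 * real n powr - a"
    \<comment> \<open>An allocation is allowed while fewer than \<open>(1 - \<delta> n) * n\<close>
      keys are live, so the capacity in keys is the ceiling.\<close>
    define m where "m = nat \<lceil>(1 - \<delta> n) * real n\<rceil>"
    have "real n powr - a' \<le> real n powr - a" using n a by (intro powr_mono) auto
    then have "K1 * real n powr - a' \<le> E"
      unfolding E_def using K1 by (intro mult_left_mono) auto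
    moreover have "\<bar>\<epsilon> n\<bar> \<le> K1 * real n powr - a'" using elim by simp
    ultimately have \<epsilon>E: "\<epsilon> n \<le> E" "0 \<le> E" by auto
    interpret prob_space M by (rule M)
    interpret fixed_size_table M D "U n" "(1 - \<delta> n) * real n" E n "q n" "s n"
    proof
      show "U n \<noteq> {}" using elim n by auto
      show "failure_bounded M D n (q n) (U n) ((1 - \<delta> n) * real n) E"
        using elim \<epsilon>E(1) unfolding supports_load_factor_def failure_bounded_def
        by (meson order_trans)
    qed (use elim n \<epsilon>E in \<open>auto simp: supports_load_factor_def fixed_size_pointers_def\<close>)
    have cap: "\<forall>t<m. real t < (1 - \<delta> n) * real n"
    proof (intro allI impI)
      fix t assume "t < m"
      then have "int t < \<lceil>(1 - \<delta> n) * real n\<rceil>" by (simp add: m_def)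
      then show "real t < (1 - \<delta> n) * real n" by (simp add: less_ceiling_iff)
    qed
    have m_le: "m \<le> n"
      using \<delta>n n by (simp add: m_def nat_le_iff ceiling_le_iff mult_le_cancel_right1)
    have m_ge: "(1 - \<delta> n) * real n \<le> real m"
      using \<delta>n by (simp add: m_def)
    moreover have "c0 * real n \<le> (1 - \<delta> n) * real n"
      using elim \<delta>n by (intro mult_right_mono) (auto simp: c0_def)
    ultimately have m0: "c0 * real n \<le> real m" by simp
    have U_large: "n ^ 2 \<le> card (U n)" using elim by simp
    have s_iterated: "ln (ln (ln (real n))) - 3 \<le> real (s n)"
    proof -
      have "ln (ln (real n)) / 4 \<le> real (card short_pointers)"
        using elim by (intro card_short_pointers_ge [OF _ c0 _ m0 m_le cap U_large]) (auto simp: E_def)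
      \<comment> \<open>The loss of 3 comes from the divisor 4 and from counting the shorter strings
        too.\<close>
      also have "\<dots> \<le> real (2 ^ Suc (s n))"
        using card_short_pointers by (simp only: of_nat_le_iff)
      finally have "ln (ln (real n)) \<le> 2 ^ (s n + 3)"
        by (simp add: power_add)
      then have "ln (ln (ln (real n))) \<le> ln (2 ^ (s n + 3))"
        using elim by (intro ln_mono) auto
      also have "\<dots> = real (s n + 3) * ln 2" by (rule ln_realpow)
      also have "\<dots> \<le> real (s n + 3) * 1"
        using ln_le_minus_one [of "2::real"] by (intro mult_left_mono) auto
      finally show ?thesis by simp
    qed
    have s_deficit: "a / b * ln (1 / \<delta> n) - G \<le> real (s n)"
    proof -
      define e where "e = E + 2 / real n"
      \<comment> \<open>The summand 1 ensures \<open>1 \<le> u\<close>. Together with rounding it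
        adds at most \<open>2 / n\<close> to \<open>\<mu>\<close>, and \<open>e\<close> contains
        another \<open>2 / n\<close>; hence \<open>K1 + 4\<close> below.\<close>
      define u where "u = nat \<lceil>real n * (\<delta> n + e) + 1\<rceil>"
      have "real n powr -1 \<le> real n powr - a"
        using n a by (intro powr_mono) auto
      then have inv_n: "1 / real n \<le> real n powr - a"
        using n by (simp add: powr_minus_divide)
      have e0: "0 \<le> e" using \<epsilon>E by (simp add: e_def)
      have nonneg: "0 \<le> real n * e" "0 \<le> real n * \<delta> n" using e0 \<delta>n by auto
      then have "0 \<le> \<lceil>real n * (\<delta> n + e) + 1\<rceil>"
        unfolding zero_le_ceiling distrib_left by linarith
      then have "real u = of_int \<lceil>real n * (\<delta> n + e) + 1\<rceil>"
        unfolding u_def by (rule of_nat_nat)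
      then have u_ge: "real n * \<delta> n + real n * e + 1 \<le> real u"
        and u_le: "real u \<le> real n * \<delta> n + real n * e + 2"
        unfolding distrib_left by linarith+
      have "c0 * real n \<le> 240 * 2 ^ s n * real u"
      proof (rule size_ge_of_deficit [OF m_le m0 cap])
        have "real (n ^ 2) \<le> real (card (U n))"
          using U_large by (simp only: of_nat_le_iff)
        then have "2 * real n / real (card (U n)) \<le> 2 * real n / real (n ^ 2)"
          using n by (intro frac_le) auto
        then show "E + 2 * real n / real (card (U n)) \<le> e"
          using n by (simp add: e_def power2_eq_square)
        show "e \<le> 1 / 16"
          using elim inv_n by (simp add: e_def E_def distrib_right)
        show "real n - real m \<le> real u"
          using m_ge u_ge nonneg by (simp add: algebra_simps)
        show "real n * e \<le> real u" using u_ge nonneg by simp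
        show "1 \<le> u" using u_ge nonneg by linarith
      qed
      define \<mu> where "\<mu> = real u / real n"
      have \<mu>: "0 < \<mu>" using u_ge nonneg n by (simp add: \<mu>_def)
      have "\<mu> \<le> \<delta> n + e + 2 / real n"
        using u_le n by (simp add: \<mu>_def field_simps)
      also have "\<dots> \<le> \<delta> n + (K1 + 4) * real n powr - a"
        using inv_n by (simp add: e_def E_def algebra_simps)
      finally have \<mu>_le: "\<mu> \<le> \<delta> n + (K1 + 4) * real n powr - a" .
      have "1 / \<delta> n \<le> K2 * real n powr b'" using elim \<delta>n by simp
      also have "\<dots> \<le> K3 * real n powr b"
        using K2 K3 b n by (intro mult_mono powr_mono) auto
      finally have "a / b * ln (1 / \<delta> n) - ln K3 - ln (K1 + 4 + 1) \<le> ln (1 / \<mu>)"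
        using a b K1 K3 n \<delta>n \<mu> \<mu>_le
        by (intro ln_inverse_le_ln_ratio) auto
      moreover have "ln (1 / \<mu>) \<le> ln (240 / c0 * 2 ^ s n)"
      proof (rule ln_mono)
        show "1 / \<mu> \<le> 240 / c0 * 2 ^ s n"
          using \<open>c0 * real n \<le> 240 * 2 ^ s n * real u\<close> c0 n u_ge nonneg
          by (simp add: \<mu>_def field_simps)
      qed (use \<mu> c0 in auto)
      moreover have "ln (240 / c0 * 2 ^ s n) = ln (240 / c0) + real (s n) * ln 2"
        using c0 by (simp add: ln_mult ln_div ln_realpow)
      moreover have "real (s n) * ln 2 \<le> real (s n) * 1"
        using ln_le_minus_one [of "2::real"] by (intro mult_left_mono) auto
      ultimately show ?thesis by (simp add: G_def add.commute)
    qed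
    have ab: "0 < a / b" "a / b \<le> 1" using a b by auto
    have lll: "0 \<le> ln (ln (ln (real n)))" using elim by simp
    have inv: "0 \<le> ln (1 / \<delta> n)" using \<delta>n by simp
    have "a / b * ln (ln (ln (real n))) \<le> 1 * ln (ln (ln (real n)))"
      using ab lll by (intro mult_right_mono) auto
    moreover have "2 * (3 + G) < ln (ln (ln (real n)))" using elim by simp
    moreover have "0 \<le> a / b * ln (1 / \<delta> n)" using less_imp_le [OF ab(1)] inv by (rule mult_nonneg_nonneg)
    ultimately have "a / b * (ln (ln (ln (real n))) + ln (1 / \<delta> n)) \<le> 4 * real (s n)"
      using s_iterated s_deficit unfolding distrib_left by linarith
    then show ?case using lll inv by simp
  qed
  then show "(\<lambda>n. real (s n)) \<in> \<Omega>(\<lambda>n. ln (ln (ln (real n))) + ln (1 / \<delta> n))"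
    using a b by (intro landau_omega.bigI [of "a / (4 * b)"]) (auto elim!: eventually_mono)
qed

end
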